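(* Let $G=(V,E)$ be a connected, locally finite graph and let $(\xi_t)_{t\ge 0}$ be coalescing random walk (CRW) on $G$ started with one particle at every vertex. For $v\in V$ and $t\ge 0$ let $p_t(v)=\mathbf{P}(\xi_t(v)=1)$, so that $\int_0^\infty p_t(v)\,dt$ is the expected total time during which $v$ is occupied. Then for every vertex $v\in V$: CRW on $G$ is site recurrent if and only if $\int_0^\infty p_t(v)\,dt=\infty$. Moreover, a 0-1 law holds: CRW on $G$ is either site recurrent or transient.
   Context: Coalescing random walk on $G=(V,E)$: each undirected edge is replaced by two directed edges, and independent unit-intensity Poisson processes (in time) are attached to the directed edges. Initially there is one particle at each vertex. When the Poisson process of the directed edge $(u,w)$ rings, any particle at $u$ moves to $w$; if there is already a particle at $w$ the two merge into one and proceed together. (So a particle at $u$ jumps at total rate $\deg u$. A particle that makes infinitely many jumps in finite time is regarded as removed.) $\xi_t\in\{0,1\}^V$ denotes the configuration of occupied vertices at time $t$: $\xi_t(v)=1$ iff $v$ is occupied at time $t$. CRW is site recurrent if almost surely every vertex is visited infinitely often, i.e. almost surely, for every vertex, the set of times at which it is occupied is unbounded. CRW is transient if the event that every vertex is visited infinitely often has probability $0$. *)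

theory Defs
  imports
    "HOL-Probability.Probability"
    "Graph_Theory.Digraph_Component"
    "Graph_Theory.Pair_Digraph"
begin

section \<open>Graphs\<close>

text \<open>
  An undirected simple graph, possibly infinite, is represented by its symmetric loop-free
  digraph (locale \<^locale>\<open>pair_bidirected_digraph\<close>): every undirected edge
  occurs as two arcs, and these arcs carry the Poisson clocks.
  Note that the constant name \<open>connected\<close> must be qualified, since
  \<^const>\<open>Topological_Spaces.connected\<close> is also in scope.
\<close>

definition locally_finite_graph :: "'v pair_pre_digraph \<Rightarrow> bool" where
  "locally_finite_graph G \<longleftrightarrow> (\<forall>v \<in> pverts G. finite (out_arcs (with_proj G) v))"

definition connected_graph :: "'v pair_pre_digraph \<Rightarrow> bool" where
  "connected_graph G \<longleftrightarrow> Digraph_Component.connected (with_proj G)"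


section \<open>Independent Poisson processes\<close>

text \<open>
  Counting process on \<open>[0,\<infinity>)\<close>; values at negative times are irrelevant.
  The subtraction on \<^typ>\<open>nat\<close> never truncates because the paths are monotone.
\<close>

definition poisson_process :: "'a measure \<Rightarrow> real \<Rightarrow> (real \<Rightarrow> 'a \<Rightarrow> nat) \<Rightarrow> bool" where
  "poisson_process M rate N \<longleftrightarrow>
     (\<forall>t\<ge>0. N t \<in> measurable M (count_space UNIV)) \<and>
     (\<forall>\<omega>\<in>space M. N 0 \<omega> = 0 \<and> mono_on {0..} (\<lambda>t. N t \<omega>) \<and>
        (\<forall>t\<ge>0. continuous (at_right t) (\<lambda>s. N s \<omega>))) \<and>
     (\<forall>s t. 0 \<le> s \<and> s < t \<longrightarrow>
        distr M (count_space UNIV) (\<lambda>\<omega>. N t \<omega> - N s \<omega>)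
          = measure_pmf (poisson_pmf (rate * (t - s)))) \<and>
     (\<forall>\<tau> :: nat \<Rightarrow> real. \<forall>n. 0 \<le> \<tau> 0 \<and> mono \<tau> \<longrightarrow>
        prob_space.indep_vars M (\<lambda>_. count_space UNIV)
          (\<lambda>i \<omega>. N (\<tau> (Suc i)) \<omega> - N (\<tau> i) \<omega>) {..<n})"

text \<open>Independence of the clocks is independence of the whole processes, seen as random elements
  of the product space indexed by time.\<close>

definition poisson_clocks ::
    "'a measure \<Rightarrow> 'v pair_pre_digraph \<Rightarrow> ('v \<times> 'v \<Rightarrow> real \<Rightarrow> 'a \<Rightarrow> nat) \<Rightarrow> bool" where
  "poisson_clocks M G N \<longleftrightarrow>
     (\<forall>e \<in> parcs G. poisson_process M 1 (N e)) \<and>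
     prob_space.indep_vars M (\<lambda>_. PiM {0..} (\<lambda>_. count_space UNIV))
       (\<lambda>e \<omega>. \<lambda>t\<in>{0..}. N e t \<omega>) (parcs G)"

definition jump_times :: "(real \<Rightarrow> nat) \<Rightarrow> real set" where
  "jump_times f = {t. 0 < t \<and> (\<forall>s. 0 \<le> s \<and> s < t \<longrightarrow> f s < f t)}"


section \<open>Coalescing random walk\<close>

text \<open>
  \<open>R e\<close> is the set of times at which the clock of the arc \<open>e\<close> rings.
  \<open>arrives G R x u s\<close>: the particle started at \<open>x\<close> arrives at \<open>u\<close> at time \<open>s\<close>, after finitely many
  jumps. Each jump is made at the first ring, after the last arrival, of an arc leaving the current
  position. A particle that jumps infinitely often in finite time has no later arrivals, so from
  then on it is nowhere. (On the null event that clocks ring simultaneously the path need not be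
  unique.)
\<close>

inductive arrives ::
    "'v pair_pre_digraph \<Rightarrow> ('v \<times> 'v \<Rightarrow> real set) \<Rightarrow> 'v \<Rightarrow> 'v \<Rightarrow> real \<Rightarrow> bool"
  for G :: "'v pair_pre_digraph" and R :: "'v \<times> 'v \<Rightarrow> real set" and x :: 'v
where
  start: "x \<in> pverts G \<Longrightarrow> arrives G R x x 0"
| jump: "\<lbrakk>arrives G R x u s; (u, w) \<in> parcs G; s < t; t \<in> R (u, w);
          \<forall>e \<in> out_arcs (with_proj G) u. R e \<inter> {s<..<t} = {}\<rbrakk> \<Longrightarrow> arrives G R x w t"

definition particle_at ::
    "'v pair_pre_digraph \<Rightarrow> ('v \<times> 'v \<Rightarrow> real set) \<Rightarrow> 'v \<Rightarrow> real \<Rightarrow> 'v \<Rightarrow> bool" where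
  "particle_at G R x t v \<longleftrightarrow>
     (\<exists>s\<le>t. arrives G R x v s \<and> (\<forall>e \<in> out_arcs (with_proj G) v. R e \<inter> {s<..t} = {}))"

text \<open>
  Coalescence needs no separate clause: particles at the same vertex obey the same clocks, hence
  stay together once they have met, and \<open>\<xi>\<close> only records which vertices are occupied.
\<close>

definition crw ::
    "'v pair_pre_digraph \<Rightarrow> ('v \<times> 'v \<Rightarrow> real \<Rightarrow> 'a \<Rightarrow> nat) \<Rightarrow> real \<Rightarrow> 'a \<Rightarrow> 'v \<Rightarrow> nat" where
  "crw G N t \<omega> v =
     (if \<exists>x \<in> pverts G. particle_at G (\<lambda>e. jump_times (\<lambda>s. N e s \<omega>)) x t v then 1 else 0)"

lemma crw_0: "v \<in> pverts G \<Longrightarrow> crw G N 0 \<omega> v = 1"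
  by (auto simp: crw_def particle_at_def intro!: bexI[of _ v] exI[of _ 0] arrives.start)

definition all_visited_infinitely_often ::
    "'v pair_pre_digraph \<Rightarrow> ('v \<times> 'v \<Rightarrow> real \<Rightarrow> 'a \<Rightarrow> nat) \<Rightarrow> 'a \<Rightarrow> bool" where
  "all_visited_infinitely_often G N \<omega> \<longleftrightarrow>
     (\<forall>v \<in> pverts G. \<not> bdd_above {t. 0 \<le> t \<and> crw G N t \<omega> v = 1})"

definition site_recurrent ::
    "'a measure \<Rightarrow> 'v pair_pre_digraph \<Rightarrow> ('v \<times> 'v \<Rightarrow> real \<Rightarrow> 'a \<Rightarrow> nat) \<Rightarrow> bool" where
  "site_recurrent M G N \<longleftrightarrow> (AE \<omega> in M. all_visited_infinitely_often G N \<omega>)"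

text \<open>Membership in \<^const>\<open>null_sets\<close> rather than an equation for \<^const>\<open>measure\<close>, which would
  hold trivially for a non-measurable set.\<close>

definition transient ::
    "'a measure \<Rightarrow> 'v pair_pre_digraph \<Rightarrow> ('v \<times> 'v \<Rightarrow> real \<Rightarrow> 'a \<Rightarrow> nat) \<Rightarrow> bool" where
  "transient M G N \<longleftrightarrow> {\<omega> \<in> space M. all_visited_infinitely_often G N \<omega>} \<in> null_sets M"

definition occupation_prob ::
    "'a measure \<Rightarrow> 'v pair_pre_digraph \<Rightarrow> ('v \<times> 'v \<Rightarrow> real \<Rightarrow> 'a \<Rightarrow> nat) \<Rightarrow> real \<Rightarrow> 'v \<Rightarrow> real" where
  "occupation_prob M G N t v = measure M {\<omega> \<in> space M. crw G N t \<omega> v = 1}"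

end

theory Submission
  imports Defs
begin

text \<open>
  If the clocks are restarted at time \<open>s\<close> with a particle at every vertex, then every site occupied
  at a time \<open>t \<ge> s\<close> is also occupied in the restarted walk, which is independent of the history up
  to \<open>s\<close> and has the law of the original walk. Decomposing according to the first visit of \<open>v\<close> at a
  positive multiple of \<open>m\<close> therefore gives \<open>p\<^bsub>km\<^esub>(v) \<le> (\<Sum>j=1..k. d\<^sub>j p\<^bsub>(k-j)m\<^esub>(v))\<close>, where \<open>\<Sum> d\<^sub>j\<close> is
  the probability of such a visit. If this probability is less than 1, then \<open>\<Sum>\<^sub>k p\<^bsub>km\<^esub>(v)\<close> converges.
  Since an occupied site stays occupied for a unit of time with a probability bounded below, the
  integral and all these series converge or diverge together. Divergence hence yields, for every
  \<open>m\<close>, almost surely a visit at a positive multiple of \<open>m\<close>, and so infinitely many visits;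
  convergence excludes them by Borel--Cantelli. Neighbouring sites are compared by letting the
  particle make one jump.
\<close>

section \<open>Counting paths\<close>

text \<open>The comparison with the restarted walk goes one way only: after a visit the actual walk
  occupies at most the sites of a fresh one, so returns cannot be iterated. One almost sure visit
  per scale is all that the renewal inequality yields. Varying the scale replaces iteration: a
  positive multiple of \<open>m\<close> is at least \<open>m\<close>. The time integral does not
  depend on the mesh of a grid, and so it carries divergence from one mesh to all others. Grids of
  deterministic times also replace stopping times, because the first visit along a grid at a given
  index is an event of the history up to a fixed time. The 0-1 law is the dichotomy between
  convergence and divergence of one series, each case deciding the outcome almost surely. The
  obstacle is foundational. The clocks are given through increments along monotone sequences of
  times, whereas the argument needs independence and stationarity of whole paths on all arcs at
  once; and occupation is defined through uncountably many possible arrival times, whereas an event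
  needs countably many alternatives.\<close>

definition counting_path :: "(real \<Rightarrow> nat) \<Rightarrow> bool" where
  "counting_path f \<longleftrightarrow>
     f 0 = 0 \<and> mono_on {0..} f \<and> (\<forall>t\<ge>0. continuous (at_right t) f)"

lemma counting_path_mono:
  assumes "counting_path f" "0 \<le> s" "s \<le> t"
  shows "f s \<le> f t"
  using assms by (auto simp: counting_path_def mono_on_def)

text \<open>The values are discrete, so right-continuity is constancy on an interval to the
  right.\<close>

lemma counting_path_right_const:
  assumes f: "counting_path f" and t: "0 \<le> t"
  obtains e where "0 < e" "\<And>s. t \<le> s \<Longrightarrow> s \<le> t + e \<Longrightarrow> f s = f t"
proof -
  have "(f \<longlongrightarrow> f t) (at_right t)"
    using f t by (auto simp: counting_path_def continuous_within)
  then have "\<forall>\<^sub>F s in at_right t. f s = f t"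
    by (simp add: tendsto_discrete)
  then obtain b where b: "t < b" "\<And>y. t < y \<Longrightarrow> y < b \<Longrightarrow> f y = f t"
    unfolding eventually_at_right_field by auto
  show thesis
  proof (rule that[of "(b - t) / 2"])
    show "0 < (b - t) / 2" using b by simp
    fix s assume "t \<le> s" "s \<le> t + (b - t) / 2"
    then show "f s = f t" using b by (cases "s = t") (auto simp: field_simps)
  qed
qed

lemma counting_path_stop:
  assumes f: "counting_path f" and s: "0 \<le> s"
  shows "counting_path (\<lambda>u. f (min u s))"
  unfolding counting_path_def
proof (intro conjI allI impI)
  show "f (min 0 s) = 0" using f s by (simp add: counting_path_def)
  show "mono_on {0..} (\<lambda>u. f (min u s))"
    by (rule mono_onI) (use counting_path_mono[OF f] s in auto)
  fix t :: real assume t: "0 \<le> t"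
  obtain e where e: "0 < e" "\<And>u. t \<le> u \<Longrightarrow> u \<le> t + e \<Longrightarrow> f u = f t"
    using counting_path_right_const[OF f t] by blast
  have "\<forall>\<^sub>F u in at_right t. f (min u s) = f (min t s)"
    unfolding eventually_at_right_field
  proof (intro exI[of _ "t + e"] conjI allI impI)
    fix y assume "t < y" "y < t + e"
    then show "f (min y s) = f (min t s)"
      using e(2)[of y] e(2)[of s] by (auto simp: min_def)
  qed (use e in simp)
  then show "continuous (at_right t) (\<lambda>u. f (min u s))"
    by (simp add: continuous_within tendsto_discrete)
qed

lemma counting_path_shift:
  assumes f: "counting_path f" and s: "0 \<le> s"
  shows "counting_path (\<lambda>u. f (s + u) - f s)"
  unfolding counting_path_def
proof (intro conjI allI impI)
  show "mono_on {0..} (\<lambda>u. f (s + u) - f s)"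
    by (rule mono_onI) (use counting_path_mono[OF f] s in \<open>auto intro!: diff_le_mono\<close>)
  fix t :: real assume t: "0 \<le> t"
  obtain e where e: "0 < e" "\<And>u. s + t \<le> u \<Longrightarrow> u \<le> s + t + e \<Longrightarrow> f u = f (s + t)"
    using counting_path_right_const[OF f, of "s + t"] t s by auto
  have "\<forall>\<^sub>F u in at_right t. f (s + u) - f s = f (s + t) - f s"
    unfolding eventually_at_right_field
  proof (intro exI[of _ "t + e"] conjI allI impI)
    fix y assume "t < y" "y < t + e"
    then show "f (s + y) - f s = f (s + t) - f s" using e(2)[of "s + y"] by simp
  qed (use e(1) in simp)
  then show "continuous (at_right t) (\<lambda>u. f (s + u) - f s)"
    by (simp add: continuous_within tendsto_discrete)
qed simp

lemma counting_path_cong: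
  assumes "\<And>t. 0 \<le> t \<Longrightarrow> f t = g t"
  shows "counting_path f \<longleftrightarrow> counting_path g"
proof -
  have "continuous (at_right t) f \<longleftrightarrow> continuous (at_right t) g" if t: "0 \<le> t" for t
  proof -
    have "\<forall>\<^sub>F s in at_right t. f s = g s"
      using assms t by (auto simp: eventually_at_filter intro!: always_eventually)
    then show ?thesis unfolding continuous_within using assms t
      by (simp add: filterlim_cong)
  qed
  moreover have "mono_on {0..} f \<longleftrightarrow> mono_on {0..} g"
    using assms by (auto simp: mono_on_def)
  ultimately show ?thesis using assms by (auto simp: counting_path_def)
qed

lemma jump_times_cong:
  assumes "\<And>t. 0 \<le> t \<Longrightarrow> f t = g t"
  shows "jump_times f = jump_times g"
  using assms by (auto simp: jump_times_def)

lemma jump_times_disjoint: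
  assumes f: "counting_path f" and "0 \<le> a" "f a = f b"
  shows "jump_times f \<inter> {a<..b} = {}"
proof -
  have False if "t \<in> jump_times f" "a < t" "t \<le> b" for t
  proof -
    have "f a < f t" using that assms by (auto simp: jump_times_def)
    also have "f t \<le> f b" using counting_path_mono[OF f] that assms by auto
    finally show False using assms by simp
  qed
  then show ?thesis by auto
qed

text \<open>Used when a particle is made to leave at the first ring of a prescribed arc. The ring is
  the infimum of the times at which the path has exceeded \<open>f a\<close>.\<close>

lemma first_jump:
  assumes f: "counting_path f" and "0 \<le> a" "f a < f b" "a \<le> b"
  obtains t where "t \<in> jump_times f" "a < t" "t \<le> b" "jump_times f \<inter> {a<..<t} = {}"
proof -
  define S where "S = {t. a \<le> t \<and> f a < f t}"
  define t where "t = Inf S"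
  have bdd: "bdd_below S" and b: "b \<in> S" using assms by (auto simp: S_def)
  have le: "t \<le> x" if "x \<in> S" for x unfolding t_def using bdd that by (rule cInf_lower[rotated])
  have at: "a \<le> t" unfolding t_def using b by (intro cInf_greatest) (auto simp: S_def)
  obtain e where e: "0 < e" "\<And>s. t \<le> s \<Longrightarrow> s \<le> t + e \<Longrightarrow> f s = f t"
    using counting_path_right_const[OF f, of t] at assms by auto
  obtain x where x: "x \<in> S" "x < t + e"
    using cInf_lessD[of S "t + e"] b e unfolding t_def by auto
  \<comment> \<open>The infimum is attained: some point of \<open>S\<close> lies in the interval to
    the right of \<open>t\<close> on which \<open>f\<close> is constant.\<close>
  have ft: "f a < f t" using x e(2)[of x] le[of x] by (auto simp: S_def)
  then have "a < t" using at by (cases "a = t") auto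
  have before: "f s \<le> f a" if "0 \<le> s" "s < t" for s
  proof (cases "a \<le> s")
    case True
    then show ?thesis using le[of s] that by (force simp: S_def)
  next
    case False
    then show ?thesis using counting_path_mono[OF f] that by simp
  qed
  show thesis
  proof (rule that[of t])
    show "t \<in> jump_times f"
      using before ft \<open>a < t\<close> assms by (force simp: jump_times_def)
    show "a < t" by fact
    show "t \<le> b" using le b by simp
    show "jump_times f \<inter> {a<..<t} = {}"
    proof -
      have False if "y \<in> jump_times f" "a < y" "y < t" for y
        using that before[of y] assms by (auto simp: jump_times_def)
      then show ?thesis by auto
    qed
  qed
qed

lemma jump_times_stop:
  assumes f: "counting_path f" and s: "0 \<le> s"
  shows "jump_times (\<lambda>u. f (min u s)) = jump_times f \<inter> {..s}"
proof -
  have "t \<le> s" if "t \<in> jump_times (\<lambda>u. f (min u s))" for t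
    using that s by (force simp: jump_times_def min_def not_le split: if_splits)
  moreover have "t \<in> jump_times (\<lambda>u. f (min u s)) \<longleftrightarrow> t \<in> jump_times f" if "t \<le> s" for t
    using that by (auto simp: jump_times_def)
  ultimately show ?thesis by blast
qed

text \<open>A ring at time \<open>s\<close> itself belongs to the past: its shifted time would be 0,
  which is never a jump time.\<close>

lemma jump_times_shift:
  assumes f: "counting_path f" and s: "0 \<le> s"
  shows "jump_times (\<lambda>u. f (s + u) - f s) = {t. 0 < t \<and> s + t \<in> jump_times f}"
proof (intro set_eqI iffI; clarify)
  fix t assume t: "t \<in> jump_times (\<lambda>u. f (s + u) - f s)"
  then have *: "0 < t" "\<And>u. 0 \<le> u \<Longrightarrow> u < t \<Longrightarrow> f (s + u) - f s < f (s + t) - f s"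
    by (auto simp: jump_times_def)
  have "f u < f (s + t)" if "0 \<le> u" "u < s + t" for u
  proof (cases "s \<le> u")
    case True
    then show ?thesis using *(2)[of "u - s"] that by simp
  next
    case False
    then show ?thesis using *(2)[of 0] * that counting_path_mono[OF f, of u s] by simp
  qed
  with * s show "0 < t \<and> s + t \<in> jump_times f" by (auto simp: jump_times_def)
next
  fix t assume t: "0 < t" "s + t \<in> jump_times f"
  then show "t \<in> jump_times (\<lambda>u. f (s + u) - f s)"
    using counting_path_mono[OF f] s by (auto simp: jump_times_def intro!: diff_less_mono)
qed

section \<open>The particle system\<close>

lemma arrives_in_verts:
  assumes "pair_wf_digraph G" "arrives G R x w t"
  shows "w \<in> pverts G"
  using assms(2)
  by (induction rule: arrives.induct) (auto dest: pair_wf_digraph.in_arcsD2[OF assms(1)])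

lemma arrives_local:
  assumes "arrives G R x w s" "s \<le> t" "\<And>e. e \<in> parcs G \<Longrightarrow> R e \<inter> {..t} = R' e \<inter> {..t}"
  shows "arrives G R' x w s"
  using assms(1,2)
proof (induction rule: arrives.induct)
  case start
  then show ?case by (auto intro: arrives.start)
next
  case (jump u s w r)
  have R: "y \<in> R e \<longleftrightarrow> y \<in> R' e" if "e \<in> parcs G" "y \<le> t" for e y
    using assms(3)[OF that(1)] that(2) by blast
  show ?case
  proof (rule arrives.jump)
    show "arrives G R' x u s" using jump by simp
    show "\<forall>e\<in>out_arcs (with_proj G) u. R' e \<inter> {s<..<r} = {}"
      unfolding disjoint_iff
    proof (intro ballI allI impI notI)
      fix e y assume e: "e \<in> out_arcs (with_proj G) u" and y: "y \<in> R' e" "y \<in> {s<..<r}"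
      then have "y \<in> R e" using R[of e y] jump.prems by auto
      then show False using jump.hyps e y by (auto simp: disjoint_iff)
    qed
  qed (use jump R in auto)
qed

text \<open>A trajectory up to \<open>t\<close> consults rings up to \<open>t\<close> only. This is
  what permits replacing clocks by stopped ones, or by others that agree at nonnegative
  times.\<close>

lemma particle_at_local:
  assumes "\<And>e. e \<in> parcs G \<Longrightarrow> R e \<inter> {..t} = R' e \<inter> {..t}"
  shows "particle_at G R x t v \<longleftrightarrow> particle_at G R' x t v"
proof -
  have *: "R e \<inter> {s<..t} = R' e \<inter> {s<..t}" if "e \<in> parcs G" for e s
  proof -
    have "{s<..t} = {..t} \<inter> {s<..t}" by auto
    then show ?thesis using assms[OF that] by (metis inf_assoc)
  qed
  have "arrives G R x v s \<longleftrightarrow> arrives G R' x v s" if "s \<le> t" for s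
    using arrives_local[of G R x v s t R'] arrives_local[of G R' x v s t R] assms that by blast
  then show ?thesis unfolding particle_at_def using * by (simp cong: conj_cong)
qed

text \<open>The pathwise core of the comparison. Whichever vertex the particle occupies at time
  \<open>s\<close>, the restarted walk has a particle there, and from then on both obey the same
  rings. That vertex is found by induction on the arrivals after \<open>s\<close>.\<close>

lemma particle_at_restart:
  assumes wf: "pair_wf_digraph G" and "particle_at G R x t v" "0 \<le> s" "s \<le> t"
    and R': "\<And>e. R' e = {u. 0 < u \<and> s + u \<in> R e}"
  shows "\<exists>y\<in>pverts G. particle_at G R' y (t - s) v"
proof -
  have no_shift: "R' e \<inter> {a - s<..<b - s} = {}" if "R e \<inter> {a<..<b} = {}" for e a b
  proof -
    have False if "y \<in> R' e" "a - s < y" "y < b - s" for y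
    proof -
      have "s + y \<in> R e \<inter> {a<..<b}" using that by (auto simp: R')
      then show False using \<open>R e \<inter> {a<..<b} = {}\<close> by auto
    qed
    then show ?thesis by auto
  qed
  have shift: "\<exists>y\<in>pverts G. arrives G R' y w (r - s)" if "arrives G R x w r" "s \<le> r" for w r
    using that
  proof (induction rule: arrives.induct)
    case start
    then show ?case using \<open>0 \<le> s\<close> by (auto intro: arrives.start)
  next
    case (jump u q w r)
    show ?case
    proof (cases "s \<le> q")
      case True
      then obtain y where y: "y \<in> pverts G" "arrives G R' y u (q - s)" using jump by auto
      have "arrives G R' y w (r - s)"
      proof (rule arrives.jump[OF y(2) jump(2)])
        show "\<forall>e\<in>out_arcs (with_proj G) u. R' e \<inter> {q - s<..<r - s} = {}"
          using jump.hyps by (intro ballI no_shift) auto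
      qed (use jump True in \<open>auto simp: R'\<close>)
      then show ?thesis using y by auto
    next
      case False
      show ?thesis
      \<comment> \<open>The jump from \<open>u\<close> to \<open>w\<close> is the first one at or
        after \<open>s\<close>. If it happens exactly at \<open>s\<close>, the shifted clocks do not
        see it, and the restarted particle begins at \<open>w\<close>; otherwise it begins at
        \<open>u\<close>, where the old particle is waiting.\<close>
      proof (cases "s = r")
        case True
        then show ?thesis
          using arrives.start[of w G R'] pair_wf_digraph.in_arcsD2[OF wf jump(2)] by auto
      next
        case sr: False
        have u: "u \<in> pverts G" by (rule pair_wf_digraph.in_arcsD1[OF wf jump(2)])
        have "arrives G R' u w (r - s)"
        proof (rule arrives.jump[OF arrives.start[OF u] jump(2)])
          have "R' e \<inter> {s - s<..<r - s} = {}" if "e \<in> out_arcs (with_proj G) u" for e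
            using jump.hyps that False by (intro no_shift) (auto simp: disjoint_iff)
          then show "\<forall>e\<in>out_arcs (with_proj G) u. R' e \<inter> {0<..<r - s} = {}" by simp
        qed (use jump sr False in \<open>auto simp: R'\<close>)
        then show ?thesis using u by auto
      qed
    qed
  qed
  obtain r where r: "r \<le> t" "arrives G R x v r"
    and none: "\<And>e. e \<in> out_arcs (with_proj G) v \<Longrightarrow> R e \<inter> {r<..t} = {}"
    using assms(2) by (auto simp: particle_at_def)
  show ?thesis
  \<comment> \<open>If the last arrival precedes \<open>s\<close>, the particle has been sitting at
    \<open>v\<close> since then, and the restarted particle of \<open>v\<close> itself
    serves.\<close>
  proof (cases "s \<le> r")
    case True
    from shift[OF r(2) True] obtain y where "y \<in> pverts G" "arrives G R' y v (r - s)" by auto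
    moreover have "\<forall>e \<in> out_arcs (with_proj G) v. R' e \<inter> {r - s<..t - s} = {}"
    proof
      fix e assume "e \<in> out_arcs (with_proj G) v"
      then have *: "R e \<inter> {r<..t} = {}" by (rule none)
      have False if "y \<in> R' e" "r - s < y" "y \<le> t - s" for y
      proof -
        have "s + y \<in> R e \<inter> {r<..t}" using that by (auto simp: R')
        then show False using * by auto
      qed
      then show "R' e \<inter> {r - s<..t - s} = {}" by auto
    qed
    ultimately show ?thesis unfolding particle_at_def using r(1)
      by (intro bexI[of _ y] exI[of _ "r - s"]) auto
  next
    case False
    have "v \<in> pverts G" using arrives_in_verts[OF wf r(2)] .
    moreover have "\<forall>e \<in> out_arcs (with_proj G) v. R' e \<inter> {0<..t - s} = {}"
      
    proof
      fix e assume "e \<in> out_arcs (with_proj G) v"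
      then have *: "R e \<inter> {r<..t} = {}" by (rule none)
      have False if "y \<in> R' e" "0 < y" "y \<le> t - s" for y
      proof -
        have "s + y \<in> R e \<inter> {r<..t}" using that False by (auto simp: R')
        then show False using * by auto
      qed
      then show "R' e \<inter> {0<..t - s} = {}" by auto
    qed
    ultimately show ?thesis using assms(4) arrives.start[of v G R']
      by (intro bexI[of _ v]) (auto simp: particle_at_def intro!: exI[of _ 0])
  qed
qed

lemma particle_at_stay:
  assumes "particle_at G R x t v" "t \<le> t'"
    and "\<And>e. e \<in> out_arcs (with_proj G) v \<Longrightarrow> R e \<inter> {t<..t'} = {}"
  shows "particle_at G R x t' v"
proof -
  obtain r where r: "r \<le> t" "arrives G R x v r"
    "\<And>e. e \<in> out_arcs (with_proj G) v \<Longrightarrow> R e \<inter> {r<..t} = {}"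
    using assms(1) by (auto simp: particle_at_def)
  have "R e \<inter> {r<..t'} = {}" if "e \<in> out_arcs (with_proj G) v" for e
  proof -
    have "{r<..t'} = {r<..t} \<union> {t<..t'}" using r assms by auto
    then show ?thesis using r(3)[OF that] assms(3)[OF that] by auto
  qed
  then show ?thesis unfolding particle_at_def using r(1,2) assms(2)
    by (intro exI[of _ r]) auto
qed

lemma particle_at_jump:
  assumes "particle_at G R x t v" "t < r" "(v, w) \<in> parcs G" "r \<in> R (v, w)"
    and none: "\<And>e. e \<in> out_arcs (with_proj G) v \<Longrightarrow> R e \<inter> {t<..<r} = {}"
  shows "particle_at G R x r w"
proof -
  obtain q where q: "q \<le> t" "arrives G R x v q"
    "\<And>e. e \<in> out_arcs (with_proj G) v \<Longrightarrow> R e \<inter> {q<..t} = {}"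
    using assms(1) by (auto simp: particle_at_def)
  have "R e \<inter> {q<..<r} = {}" if "e \<in> out_arcs (with_proj G) v" for e
  proof -
    have "{q<..<r} = {q<..t} \<union> {t<..<r}" using q assms by auto
    then show ?thesis using q(3)[OF that] none[OF that] by auto
  qed
  then have "arrives G R x w r"
    using q assms by (intro arrives.jump[OF q(2) assms(3)]) auto
  then show ?thesis by (auto simp: particle_at_def)
qed

section \<open>Measurability of the occupied sites\<close>

lemma pred_Bex_countable:
  assumes "countable I" "\<And>i. i \<in> I \<Longrightarrow> Measurable.pred M (\<lambda>x. P x i)"
  shows "Measurable.pred M (\<lambda>x. \<exists>i\<in>I. P x i)"
proof -
  have "{x \<in> space M. \<exists>i\<in>I. P x i} = (\<Union>i\<in>I. {x \<in> space M. P x i})" by auto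
  also have "\<dots> \<in> sets M"
    using assms by (intro sets.countable_UN'') (auto simp: pred_def)
  finally show ?thesis by (simp add: pred_def)
qed

lemma pred_Ball_countable:
  assumes "countable I" "\<And>i. i \<in> I \<Longrightarrow> Measurable.pred M (\<lambda>x. P x i)"
  shows "Measurable.pred M (\<lambda>x. \<forall>i\<in>I. P x i)"
proof -
  have "Measurable.pred M (\<lambda>x. \<not> (\<exists>i\<in>I. \<not> P x i))"
    using assms by (intro pred_intros_logic pred_Bex_countable)
  then show ?thesis by simp
qed

text \<open>The first time at which the path exceeds \<open>k\<close>, or infinity if it never does.
  Taking the infimum over rational times makes it measurable, and right-continuity ensures that
  nothing is lost.\<close>

definition ring_time :: "(real \<Rightarrow> nat) \<Rightarrow> nat \<Rightarrow> ereal" where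
  "ring_time f k = (INF q\<in>{q\<in>\<rat>. 0 \<le> q}. if k < f q then ereal q else \<infinity>)"

lemma ring_time_less_iff:
  "ring_time f k < ereal x \<longleftrightarrow> (\<exists>q\<in>\<rat>. 0 \<le> q \<and> q < x \<and> k < f q)"
  unfolding ring_time_def INF_less_iff by (auto split: if_splits)

text \<open>A jump at \<open>t\<close> is where the level \<open>f t - 1\<close> is first exceeded.
  A jump higher than 1 gives the same time for several \<open>k\<close>, which is harmless for an
  equality of sets.\<close>

lemma jump_times_eq_ring_time:
  assumes f: "counting_path f"
  shows "jump_times f = {t. \<exists>k. ring_time f k = ereal t}"
proof (intro set_eqI iffI; clarify)
  fix t assume t: "t \<in> jump_times f"
  then have t0: "0 < t" and lt: "\<And>s. 0 \<le> s \<Longrightarrow> s < t \<Longrightarrow> f s < f t"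
    by (auto simp: jump_times_def)
  \<comment> \<open>Positivity keeps \<open>f t - 1\<close> from truncating.\<close>
  have pos: "0 < f t" using lt[of 0] t0 by simp
  have "\<not> ring_time f (f t - 1) < ereal t"
    unfolding ring_time_less_iff using lt pos by force
  moreover have "\<not> ereal t < ring_time f (f t - 1)"
  proof
    assume "ereal t < ring_time f (f t - 1)"
    then obtain x where x: "t < x" "ereal x < ring_time f (f t - 1)"
      using ereal_dense2 by (metis ereal_less_eq(3) less_ereal.simps(1))
    obtain q where q: "q \<in> \<rat>" "t < q" "q < x"
      using Rats_dense_in_real[OF x(1)] by blast
    have "f t - 1 < f q"
      using counting_path_mono[OF f, of t q] q t0 pos by simp
    then have "ring_time f (f t - 1) < ereal x"
      unfolding ring_time_less_iff using q t0 by (intro bexI[of _ q]) auto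
    with x show False by simp
  qed
  ultimately have "ring_time f (f t - 1) = ereal t" by simp
  then show "\<exists>k. ring_time f k = ereal t" by blast
next
  fix t k assume eq: "ring_time f k = ereal t"
  have before: "f s \<le> k" if "0 \<le> s" "s < t" for s
  proof (rule ccontr)
    assume "\<not> f s \<le> k"
    obtain q where q: "q \<in> \<rat>" "s < q" "q < t"
      using Rats_dense_in_real[OF \<open>s < t\<close>] by blast
    have "ring_time f k < ereal t"
      unfolding ring_time_less_iff using q that counting_path_mono[OF f, of s q] \<open>\<not> f s \<le> k\<close>
      by (intro bexI[of _ q]) auto
    with eq show False by simp
  qed
  have t: "0 \<le> t"
  proof (rule ccontr)
    assume "\<not> 0 \<le> t"
    then have "ring_time f k < ereal 0" using eq by simp
    then show False unfolding ring_time_less_iff by auto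
  qed
  obtain e where e: "0 < e" "\<And>s. t \<le> s \<Longrightarrow> s \<le> t + e \<Longrightarrow> f s = f t"
    using counting_path_right_const[OF f t] by blast
  have "ring_time f k < ereal (t + e)" using eq e by simp
  then obtain q where q: "0 \<le> q" "q < t + e" "k < f q"
    unfolding ring_time_less_iff by auto
  have "t \<le> q" using before[of q] q by (meson not_le)
  then have ft: "k < f t" using e(2)[of q] q by simp
  then have "0 < t" using t f by (cases "t = 0") (auto simp: counting_path_def)
  then show "t \<in> jump_times f" using before ft by (force simp: jump_times_def)
qed

lemma borel_measurable_ring_time:
  assumes "\<And>t. 0 \<le> t \<Longrightarrow> (\<lambda>\<omega>. g \<omega> t) \<in> measurable M (count_space UNIV)"
  shows "(\<lambda>\<omega>. ring_time (g \<omega>) k) \<in> borel_measurable M"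
proof -
  have "(\<lambda>\<omega>. if k < g \<omega> q then ereal q else \<infinity>) \<in> borel_measurable M" if "q \<in> {q \<in> \<rat>. 0 \<le> q}" for q
  proof -
    have [measurable]: "(\<lambda>\<omega>. g \<omega> q) \<in> measurable M (count_space UNIV)" using assms that by simp
    show ?thesis by measurable
  qed
  then show ?thesis unfolding ring_time_def
    by (intro borel_measurable_INF) (auto intro: countable_subset[OF _ countable_rat])
qed

text \<open>A label \<open>(e, k)\<close> stands for the \<open>k\<close>-th ring of the arc \<open>e\<close> (counted from 0), and a list of labels, latest
  first, for the successive jumps of a particle: there are only countably many such itineraries.\<close>

definition label_pos :: "'v \<Rightarrow> (('v \<times> 'v) \<times> nat) list \<Rightarrow> 'v" where
  "label_pos x ls = (case ls of [] \<Rightarrow> x | l # _ \<Rightarrow> snd (fst l))"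

definition label_time :: "('v \<times> 'v \<Rightarrow> nat \<Rightarrow> ereal) \<Rightarrow> (('v \<times> 'v) \<times> nat) list \<Rightarrow> ereal" where
  "label_time T ls = (case ls of [] \<Rightarrow> 0 | l # _ \<Rightarrow> T (fst l) (snd l))"

primrec itinerary ::
    "'v pair_pre_digraph \<Rightarrow> ('v \<times> 'v \<Rightarrow> nat \<Rightarrow> ereal) \<Rightarrow> 'v \<Rightarrow> (('v \<times> 'v) \<times> nat) list \<Rightarrow> bool"
where
  "itinerary G T x [] \<longleftrightarrow> x \<in> pverts G"
| "itinerary G T x (l # ls) \<longleftrightarrow>
     itinerary G T x ls \<and> fst l \<in> parcs G \<and> fst (fst l) = label_pos x ls \<and>
     label_time T ls < T (fst l) (snd l) \<and> T (fst l) (snd l) < \<infinity> \<and>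
     (\<forall>e\<in>out_arcs (with_proj G) (label_pos x ls). \<forall>k.
        \<not> (label_time T ls < T e k \<and> T e k < T (fst l) (snd l)))"

lemma label_time_nonneg: "itinerary G T x ls \<Longrightarrow> 0 \<le> label_time T ls"
  by (induction ls) (auto simp: label_time_def split: list.splits dest: order.trans)

lemma no_ring_iff:
  assumes "R = {t. \<exists>k. T k = ereal t}"
  shows "R \<inter> {s<..<t} = {} \<longleftrightarrow> (\<forall>k. \<not> (ereal s < T k \<and> T k < ereal t))"
    and "R \<inter> {s<..t} = {} \<longleftrightarrow> (\<forall>k. \<not> (ereal s < T k \<and> T k \<le> ereal t))"
proof -
  show "R \<inter> {s<..<t} = {} \<longleftrightarrow> (\<forall>k. \<not> (ereal s < T k \<and> T k < ereal t))"
    (is "?l \<longleftrightarrow> ?r")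
  proof
    show ?r if l: ?l
    proof (intro allI notI)
      fix k assume k: "ereal s < T k \<and> T k < ereal t"
      then obtain u where "T k = ereal u" by (cases "T k") auto
      with k l show False by (auto simp: assms disjoint_iff)
    qed
    show ?l if ?r
    proof -
      have False if "T k = ereal u" "s < u" "u < t" for k u
        using \<open>?r\<close>[rule_format, of k] that by simp
      then show ?thesis by (auto simp: assms)
    qed
  qed
  show "R \<inter> {s<..t} = {} \<longleftrightarrow> (\<forall>k. \<not> (ereal s < T k \<and> T k \<le> ereal t))"
    (is "?l \<longleftrightarrow> ?r")
  proof
    show ?r if l: ?l
    proof (intro allI notI)
      fix k assume k: "ereal s < T k \<and> T k \<le> ereal t"
      then obtain u where "T k = ereal u" by (cases "T k") auto
      with k l show False by (auto simp: assms disjoint_iff)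
    qed
    show ?l if ?r
    proof -
      have False if "T k = ereal u" "s < u" "u \<le> t" for k u
        using \<open>?r\<close>[rule_format, of k] that by simp
      then show ?thesis by (auto simp: assms)
    qed
  qed
qed

text \<open>The indices of the rings along a trajectory determine it. The gain is countability: the
  real times hidden in \<open>arrives\<close> give way to finite lists of labels. Labels range over
  arcs of the graph, since the ring times are controlled only there.\<close>

lemma arrives_iff_itinerary:
  assumes R: "\<And>e. e \<in> parcs G \<Longrightarrow> R e = {t. \<exists>k. T e k = ereal t}"
  shows "arrives G R x w t \<longleftrightarrow>
    (\<exists>ls\<in>lists (parcs G \<times> UNIV). itinerary G T x ls \<and> label_pos x ls = w \<and> label_time T ls = ereal t)"
proof
  assume "arrives G R x w t"
  then show "\<exists>ls\<in>lists (parcs G \<times> UNIV). itinerary G T x ls \<and> label_pos x ls = w \<and> label_time T ls = ereal t"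
  proof (induction rule: arrives.induct)
    case start
    then show ?case by (intro bexI[of _ "[]"]) (auto simp: label_pos_def label_time_def zero_ereal_def)
  next
    case (jump u s w t)
    then obtain ls where ls: "ls \<in> lists (parcs G \<times> UNIV)" "itinerary G T x ls"
      "label_pos x ls = u" "label_time T ls = ereal s" by blast
    obtain k where k: "T (u, w) k = ereal t" using jump R by blast
    have "\<forall>e\<in>out_arcs (with_proj G) u. \<forall>k. \<not> (ereal s < T e k \<and> T e k < ereal t)"
      using jump.hyps no_ring_iff(1)[OF R] by simp
    then show ?case using ls jump.hyps k
      by (intro bexI[of _ "((u, w), k) # ls"]) (auto simp: label_pos_def label_time_def)
  qed
next
  assume "\<exists>ls\<in>lists (parcs G \<times> UNIV). itinerary G T x ls \<and> label_pos x ls = w \<and> label_time T ls = ereal t"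
  then obtain ls where "itinerary G T x ls" "label_pos x ls = w" "label_time T ls = ereal t" by blast
  then show "arrives G R x w t"
  proof (induction ls arbitrary: w t)
    case Nil
    then show ?case
      by (auto simp: label_pos_def label_time_def zero_ereal_def intro: arrives.start)
  next
    case (Cons l ls)
    let ?u = "label_pos x ls"
    have fl: "fst l = (?u, w)"
      using Cons.prems by (simp add: label_pos_def prod_eq_iff)
    have it: "itinerary G T x ls" using Cons.prems by simp
    have l: "(?u, w) \<in> parcs G" "T (?u, w) (snd l) = ereal t"
      using Cons.prems fl by (auto simp: label_time_def)
    then have lt: "label_time T ls < ereal t"
      and none: "\<And>e k. e \<in> out_arcs (with_proj G) ?u \<Longrightarrow> \<not> (label_time T ls < T e k \<and> T e k < ereal t)"
      using Cons.prems fl by auto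
    obtain s where s: "label_time T ls = ereal s"
      using label_time_nonneg[OF it] lt by (cases "label_time T ls") auto
    show ?case
    proof (rule arrives.jump)
      show "arrives G R x ?u s" using Cons.IH it s by blast
      show "\<forall>e\<in>out_arcs (with_proj G) ?u. R e \<inter> {s<..<t} = {}"
        using none no_ring_iff(1)[OF R] s by simp
    qed (use l R lt s in auto)
  qed
qed

lemma particle_at_iff_itinerary:
  assumes R: "\<And>e. e \<in> parcs G \<Longrightarrow> R e = {t. \<exists>k. T e k = ereal t}"
  shows "particle_at G R x t v \<longleftrightarrow>
    (\<exists>ls\<in>lists (parcs G \<times> UNIV). itinerary G T x ls \<and> label_pos x ls = v \<and> label_time T ls \<le> ereal t \<and>
       (\<forall>e\<in>out_arcs (with_proj G) v. \<forall>k. \<not> (label_time T ls < T e k \<and> T e k \<le> ereal t)))"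
    (is "_ \<longleftrightarrow> ?rhs")
proof
  assume "particle_at G R x t v"
  then obtain s where s: "s \<le> t" "arrives G R x v s"
    and none: "\<And>e. e \<in> out_arcs (with_proj G) v \<Longrightarrow> R e \<inter> {s<..t} = {}"
    by (auto simp: particle_at_def)
  from s(2) obtain ls where ls: "ls \<in> lists (parcs G \<times> UNIV)" "itinerary G T x ls"
      "label_pos x ls = v" "label_time T ls = ereal s" using arrives_iff_itinerary[of G R T, OF R] by blast
  have "\<forall>e\<in>out_arcs (with_proj G) v. \<forall>k. \<not> (label_time T ls < T e k \<and> T e k \<le> ereal t)"
    using none no_ring_iff(2)[OF R] ls(4) by simp
  with ls s show ?rhs by (intro bexI[of _ ls]) auto
next
  assume ?rhs
  then obtain ls where ls: "ls \<in> lists (parcs G \<times> UNIV)" "itinerary G T x ls"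
      "label_pos x ls = v" "label_time T ls \<le> ereal t"
      and none: "\<And>e k. e \<in> out_arcs (with_proj G) v \<Longrightarrow> \<not> (label_time T ls < T e k \<and> T e k \<le> ereal t)"
    by blast
  obtain s where s: "label_time T ls = ereal s" "s \<le> t"
    using label_time_nonneg[OF ls(2)] ls(4) by (cases "label_time T ls") auto
  have "arrives G R x v s" using arrives_iff_itinerary[of G R T, OF R] ls s by blast
  moreover have "\<forall>e\<in>out_arcs (with_proj G) v. R e \<inter> {s<..t} = {}"
    using none no_ring_iff(2)[OF R] s by simp
  ultimately show "particle_at G R x t v" using s by (auto simp: particle_at_def)
qed

lemma measurable_label_time:
  assumes "\<And>e k. e \<in> parcs G \<Longrightarrow> (\<lambda>\<omega>. T \<omega> e k) \<in> borel_measurable M"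
    and "ls \<in> lists (parcs G \<times> UNIV)"
  shows "(\<lambda>\<omega>. label_time (T \<omega>) ls) \<in> borel_measurable M"
  using assms by (cases ls) (auto simp: label_time_def)

lemma pred_itinerary:
  assumes T: "\<And>e k. e \<in> parcs G \<Longrightarrow> (\<lambda>\<omega>. T \<omega> e k) \<in> borel_measurable M"
    and ctbl: "countable (parcs G)"
    and "ls \<in> lists (parcs G \<times> UNIV)"
  shows "Measurable.pred M (\<lambda>\<omega>. itinerary G (T \<omega>) x ls)"
  using assms(3)
proof (induction ls)
  case Nil
  then show ?case by simp
next
  case (Cons l ls)
  then have [measurable]: "Measurable.pred M (\<lambda>\<omega>. itinerary G (T \<omega>) x ls)"
    and [measurable]: "(\<lambda>\<omega>. label_time (T \<omega>) ls) \<in> borel_measurable M"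
    and [measurable]: "(\<lambda>\<omega>. T \<omega> (fst l) (snd l)) \<in> borel_measurable M"
    by (auto intro!: measurable_label_time T)
  have "Measurable.pred M (\<lambda>\<omega>. \<forall>e\<in>out_arcs (with_proj G) (label_pos x ls). \<forall>k.
        \<not> (label_time (T \<omega>) ls < T \<omega> e k \<and> T \<omega> e k < T \<omega> (fst l) (snd l)))"
  proof (rule pred_Ball_countable)
    show "countable (out_arcs (with_proj G) (label_pos x ls))"
      by (rule countable_subset[OF _ ctbl]) auto
    fix e assume "e \<in> out_arcs (with_proj G) (label_pos x ls)"
    then have [measurable]: "(\<lambda>\<omega>. T \<omega> e k) \<in> borel_measurable M" for k using T by auto
    show "Measurable.pred M (\<lambda>\<omega>. \<forall>k. \<not> (label_time (T \<omega>) ls < T \<omega> e k \<and> T \<omega> e k < T \<omega> (fst l) (snd l)))"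
      by measurable
  qed
  note [measurable] = this
  show ?case unfolding itinerary.simps by measurable
qed

lemma pred_particle_at:
  assumes g: "\<And>e t. e \<in> parcs G \<Longrightarrow> 0 \<le> t \<Longrightarrow> (\<lambda>\<omega>. g \<omega> e t) \<in> measurable M (count_space UNIV)"
    and path: "\<And>\<omega> e. \<omega> \<in> space M \<Longrightarrow> e \<in> parcs G \<Longrightarrow> counting_path (g \<omega> e)"
    and ctbl: "countable (parcs G)"
  shows "Measurable.pred M (\<lambda>\<omega>. particle_at G (\<lambda>e. jump_times (g \<omega> e)) x t v)"
proof -
  define T where "T \<omega> e = ring_time (g \<omega> e)" for \<omega> e
  have T [measurable]: "(\<lambda>\<omega>. T \<omega> e k) \<in> borel_measurable M" if "e \<in> parcs G" for e k
    unfolding T_def using g[OF that] by (rule borel_measurable_ring_time)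
  have "Measurable.pred M (\<lambda>\<omega>. \<exists>ls\<in>lists (parcs G \<times> UNIV). itinerary G (T \<omega>) x ls \<and> label_pos x ls = v \<and>
       label_time (T \<omega>) ls \<le> ereal t \<and>
       (\<forall>e\<in>out_arcs (with_proj G) v. \<forall>k. \<not> (label_time (T \<omega>) ls < T \<omega> e k \<and> T \<omega> e k \<le> ereal t)))"
  proof (rule pred_Bex_countable)
    show "countable (lists (parcs G \<times> (UNIV :: nat set)))" using ctbl by simp
    fix ls :: "(('a \<times> 'a) \<times> nat) list" assume ls: "ls \<in> lists (parcs G \<times> UNIV)"
    have [measurable]: "Measurable.pred M (\<lambda>\<omega>. itinerary G (T \<omega>) x ls)"
      by (rule pred_itinerary[OF T ctbl ls])
    have [measurable]: "(\<lambda>\<omega>. label_time (T \<omega>) ls) \<in> borel_measurable M"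
      by (rule measurable_label_time[OF T ls])
    have [measurable]: "Measurable.pred M (\<lambda>\<omega>. \<forall>e\<in>out_arcs (with_proj G) v. \<forall>k.
        \<not> (label_time (T \<omega>) ls < T \<omega> e k \<and> T \<omega> e k \<le> ereal t))"
    proof (rule pred_Ball_countable)
      show "countable (out_arcs (with_proj G) v)"
        by (rule countable_subset[OF _ ctbl]) auto
      fix e assume "e \<in> out_arcs (with_proj G) v"
      then have [measurable]: "(\<lambda>\<omega>. T \<omega> e k) \<in> borel_measurable M" for k using T by auto
      show "Measurable.pred M (\<lambda>\<omega>. \<forall>k. \<not> (label_time (T \<omega>) ls < T \<omega> e k \<and> T \<omega> e k \<le> ereal t))"
        by measurable
    qed
    show "Measurable.pred M (\<lambda>\<omega>. itinerary G (T \<omega>) x ls \<and> label_pos x ls = v \<and>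
       label_time (T \<omega>) ls \<le> ereal t \<and>
       (\<forall>e\<in>out_arcs (with_proj G) v. \<forall>k. \<not> (label_time (T \<omega>) ls < T \<omega> e k \<and> T \<omega> e k \<le> ereal t)))"
      by measurable
  qed
  then show ?thesis
  proof (rule measurable_cong[THEN iffD1, rotated])
    fix \<omega> assume "\<omega> \<in> space M"
    then have "jump_times (g \<omega> e) = {t. \<exists>k. T \<omega> e k = ereal t}" if "e \<in> parcs G" for e
      unfolding T_def using path that by (intro jump_times_eq_ring_time)
    from particle_at_iff_itinerary[of G "\<lambda>e. jump_times (g \<omega> e)" "T \<omega>" x t v, OF this]
    show "(\<exists>ls\<in>lists (parcs G \<times> UNIV). itinerary G (T \<omega>) x ls \<and> label_pos x ls = v \<and>
       label_time (T \<omega>) ls \<le> ereal t \<and>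
       (\<forall>e\<in>out_arcs (with_proj G) v. \<forall>k. \<not> (label_time (T \<omega>) ls < T \<omega> e k \<and> T \<omega> e k \<le> ereal t)))
       = particle_at G (\<lambda>e. jump_times (g \<omega> e)) x t v" by simp
  qed
qed

definition occupied :: "'v pair_pre_digraph \<Rightarrow> ('v \<times> 'v \<Rightarrow> real \<Rightarrow> nat) \<Rightarrow> real \<Rightarrow> 'v \<Rightarrow> bool" where
  "occupied G g t v \<longleftrightarrow> (\<exists>x\<in>pverts G. particle_at G (\<lambda>e. jump_times (g e)) x t v)"

abbreviation path_space :: "real set \<Rightarrow> (real \<Rightarrow> nat) measure" where
  "path_space I \<equiv> PiM I (\<lambda>_. count_space UNIV)"

abbreviation clock_space :: "'e set \<Rightarrow> ('e \<Rightarrow> real \<Rightarrow> nat) measure" where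
  "clock_space E \<equiv> PiM E (\<lambda>_. path_space {0..})"

text \<open>Restricting to \<open>E\<close> and to nonnegative times yields a point of the product
  space \<open>clock_space E\<close>, whose elements are undefined outside the index sets.\<close>

definition clock_paths :: "'e set \<Rightarrow> ('e \<Rightarrow> real \<Rightarrow> nat) \<Rightarrow> 'e \<Rightarrow> real \<Rightarrow> nat" where
  "clock_paths E g = (\<lambda>e\<in>E. \<lambda>t\<in>{0..}. g e t)"

lemma occupied_cong:
  assumes "\<And>e t. e \<in> parcs G \<Longrightarrow> 0 \<le> t \<Longrightarrow> g e t = h e t"
  shows "occupied G g r v \<longleftrightarrow> occupied G h r v"
  unfolding occupied_def
  using assms by (intro bex_cong refl particle_at_local arg_cong2[where f = "(\<inter>)"] jump_times_cong) auto

text \<open>The set of counting paths is not measurable in the product space, so that the event of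
  occupation is only measurable relative to it.\<close>

lemma occupied_event:
  assumes "countable (pverts G)" "countable (parcs G)"
  obtains A where "A \<in> sets (clock_space (parcs G))"
    "\<And>g. (\<And>e. e \<in> parcs G \<Longrightarrow> counting_path (g e)) \<Longrightarrow>
       clock_paths (parcs G) g \<in> A \<longleftrightarrow> occupied G g r v"
proof -
  let ?E = "parcs G"
  define W where "W = {g. \<forall>e\<in>?E. counting_path (g e)}"
  let ?Q = "restrict_space (clock_space ?E) W"
  have "Measurable.pred ?Q (\<lambda>g. occupied G g r v)"
    unfolding occupied_def
  proof (intro pred_Bex_countable assms(1) pred_particle_at assms(2))
    fix e :: "'a \<times> 'a" and t :: real assume "e \<in> ?E" "0 \<le> t"
    then have "(\<lambda>g. g e) \<in> measurable (clock_space ?E) (path_space {0..})"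
      and "(\<lambda>f. f t) \<in> measurable (path_space {0..}) (count_space UNIV)"
      by (auto intro!: measurable_component_singleton)
    from measurable_compose[OF this] show "(\<lambda>g. g e t) \<in> measurable ?Q (count_space UNIV)"
      by (rule measurable_restrict_space1)
  next
    fix g e assume "g \<in> space ?Q" "e \<in> ?E"
    then show "counting_path (g e)" by (auto simp: W_def space_restrict_space)
  qed
  then have "{g \<in> space ?Q. occupied G g r v} \<in> sets ?Q" by measurable
  \<comment> \<open>Sets of the trace sigma-algebra on \<open>W\<close> are traces of measurable
    sets of the full product space. Outside \<open>W\<close> the set \<open>A\<close> carries no
    meaning, but the families of clocks never leave \<open>W\<close>.\<close>
  then obtain A where A: "A \<in> sets (clock_space ?E)" "{g \<in> space ?Q. occupied G g r v} = W \<inter> A"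
    unfolding sets_restrict_space by auto
  have "clock_paths ?E g \<in> A \<longleftrightarrow> occupied G g r v"
    if g: "\<And>e. e \<in> ?E \<Longrightarrow> counting_path (g e)" for g
  proof -
    have "counting_path (clock_paths ?E g e)" if "e \<in> ?E" for e
      using g[OF that] that by (subst counting_path_cong[of _ "g e"]) (auto simp: clock_paths_def)
    then have W: "clock_paths ?E g \<in> W" by (auto simp: W_def)
    have "clock_paths ?E g \<in> space (clock_space ?E)"
      by (auto simp: clock_paths_def space_PiM PiE_iff)
    then have "clock_paths ?E g \<in> space ?Q" using W by (auto simp: space_restrict_space)
    moreover have "occupied G (clock_paths ?E g) r v \<longleftrightarrow> occupied G g r v"
      by (rule occupied_cong) (auto simp: clock_paths_def)
    ultimately show ?thesis using A(2) W by blast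
  qed
  with A(1) show thesis by (rule that)
qed

section \<open>The Markov property of the clocks\<close>

text \<open>Preimages of cylinders form an intersection-stable generator, so the independence of two
  product-valued variables can be tested on finitely many coordinates. This is how independence of
  finitely many increments becomes independence of whole paths.\<close>

lemma (in prob_space) indep_var_PiM:
  assumes X: "X \<in> measurable M (PiM I S)" and Y: "Y \<in> measurable M (PiM K T)"
    and eq: "\<And>J A L B. finite J \<Longrightarrow> J \<subseteq> I \<Longrightarrow> (\<And>j. j \<in> J \<Longrightarrow> A j \<in> sets (S j)) \<Longrightarrow>
      finite L \<Longrightarrow> L \<subseteq> K \<Longrightarrow> (\<And>l. l \<in> L \<Longrightarrow> B l \<in> sets (T l)) \<Longrightarrow>
      prob {\<omega>\<in>space M. (\<forall>j\<in>J. X \<omega> j \<in> A j) \<and> (\<forall>l\<in>L. Y \<omega> l \<in> B l)} =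
      prob {\<omega>\<in>space M. \<forall>j\<in>J. X \<omega> j \<in> A j} * prob {\<omega>\<in>space M. \<forall>l\<in>L. Y \<omega> l \<in> B l}"
  shows "indep_var (PiM I S) X (PiM K T) Y"
proof -
  define gen where "gen V I S = {V -` A \<inter> space M |A. A \<in> prod_algebra I S}"
    for V :: "'a \<Rightarrow> 'b \<Rightarrow> 'c" and I S
  have sigma: "sigma_sets (space M) {V -` A \<inter> space M |A. A \<in> sets (PiM I S)} =
      sigma_sets (space M) (gen V I S)"
    if V: "V \<in> measurable M (PiM I S)" for V :: "'a \<Rightarrow> 'b \<Rightarrow> 'c" and I S
  proof -
    have "V \<in> space M \<rightarrow> (\<Pi>\<^sub>E i\<in>I. space (S i))"
      using measurable_space[OF V] by (auto simp: space_PiM)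
    from sigma_sets_vimage_commute[OF this, of "prod_algebra I S"]
    have "{V -` A \<inter> space M |A. A \<in> sets (PiM I S)} = sigma_sets (space M) (gen V I S)"
      unfolding sets_PiM gen_def .
    moreover have "gen V I S \<subseteq> Pow (space M)" by (auto simp: gen_def)
    ultimately show ?thesis by (simp add: sigma_sets_sigma_sets_eq)
  qed
  have stable: "Int_stable (gen V I S)" for V :: "'a \<Rightarrow> 'b \<Rightarrow> 'c" and I S
    unfolding Int_stable_def gen_def
  proof clarify
    fix A B assume "A \<in> prod_algebra I S" "B \<in> prod_algebra I S"
    then have "A \<inter> B \<in> prod_algebra I S"
      using Int_stable_prod_algebra by (auto simp: Int_stable_def)
    then show "\<exists>C. V -` A \<inter> space M \<inter> (V -` B \<inter> space M) = V -` C \<inter> space M \<and> C \<in> prod_algebra I S"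
      by (intro exI[of _ "A \<inter> B"]) auto
  qed
  have gen_ev: "gen V I S \<subseteq> events" if V: "V \<in> measurable M (PiM I S)"
    for V :: "'a \<Rightarrow> 'b \<Rightarrow> 'c" and I S
    using measurable_sets[OF V] by (auto simp: gen_def sets_PiM)
  have genE: "\<exists>J A. finite J \<and> J \<subseteq> I \<and> (\<forall>j\<in>J. A j \<in> sets (S j)) \<and> a = {\<omega>\<in>space M. \<forall>j\<in>J. V \<omega> j \<in> A j}"
    if V: "V \<in> measurable M (PiM I S)" and a: "a \<in> gen V I S"
    for V :: "'a \<Rightarrow> 'b \<Rightarrow> 'c" and I S a
  proof -
    from a obtain J E where J: "a = V -` prod_emb I S J (\<Pi>\<^sub>E j\<in>J. E j) \<inter> space M"
      "finite J" "J \<subseteq> I" "\<And>i. i \<in> J \<Longrightarrow> E i \<in> sets (S i)"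
      unfolding gen_def by (auto elim!: prod_algebraE)
    have "a = {\<omega>\<in>space M. \<forall>j\<in>J. V \<omega> j \<in> E j}"
      using measurable_space[OF V] J(3) unfolding J(1)
      by (auto simp: prod_emb_def space_PiM PiE_iff)
    with J(2-4) show ?thesis by (intro exI[of _ J] exI[of _ E] conjI ballI)
  qed
  have "indep_set (gen X I S) (gen Y K T)"
  proof (rule indep_setI)
    fix a b assume a: "a \<in> gen X I S" and b: "b \<in> gen Y K T"
    obtain J A where J: "finite J \<and> J \<subseteq> I \<and> (\<forall>j\<in>J. A j \<in> sets (S j)) \<and>
        a = {\<omega>\<in>space M. \<forall>j\<in>J. X \<omega> j \<in> A j}" using genE[OF X a] by (elim exE)
    obtain L B where L: "finite L \<and> L \<subseteq> K \<and> (\<forall>l\<in>L. B l \<in> sets (T l)) \<and>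
        b = {\<omega>\<in>space M. \<forall>l\<in>L. Y \<omega> l \<in> B l}" using genE[OF Y b] by (elim exE)
    have "a \<inter> b = {\<omega>\<in>space M. (\<forall>j\<in>J. X \<omega> j \<in> A j) \<and> (\<forall>l\<in>L. Y \<omega> l \<in> B l)}"
      using J L by auto
    then show "prob (a \<inter> b) = prob a * prob b"
      using eq[of J A L B] J L by simp
  qed (use gen_ev X Y in auto)
  from indep_set_sigma_sets[OF this stable stable] show ?thesis
    unfolding indep_var_eq sigma[OF X] sigma[OF Y] using X Y by simp
qed

text \<open>Independence of increments is stated along monotone sequences; this places a finite set
  of times on such a sequence, starting at 0 so that values of a process are sums of
  increments.\<close>

lemma finite_time_grid:
  fixes J :: "real set"
  assumes "finite J" "J \<subseteq> {0..}"
  obtains \<tau> :: "nat \<Rightarrow> real" and n where "\<tau> 0 = 0" "mono \<tau>" "J \<subseteq> \<tau> ` {..<n}" "0 < n"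
proof -
  define xs where "xs = sorted_list_of_set (insert 0 J)"
  have set: "set xs = insert 0 J" and sorted: "sorted xs"
    using assms(1) unfolding xs_def by (simp_all only: finite_insert set_sorted_list_of_set sorted_sorted_list_of_set)
  then have len: "0 < length xs" by (cases xs) auto
  \<comment> \<open>Capping the index makes the sequence constant after the last time, hence
    monotone on all of \<open>nat\<close>.\<close>
  define \<tau> where "\<tau> i = xs ! (min i (length xs - 1))" for i
  show thesis
  proof (rule that[of \<tau> "length xs"])
    show "mono \<tau>"
    proof (rule monoI)
      fix i j :: nat assume "i \<le> j"
      then have "min i (length xs - 1) \<le> min j (length xs - 1)" by simp
      moreover have "min j (length xs - 1) < length xs" using len by linarith
      ultimately show "\<tau> i \<le> \<tau> j" unfolding \<tau>_def by (rule sorted_nth_mono[OF sorted])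
    qed
    have "xs ! 0 \<le> 0"
    proof -
      obtain i where "i < length xs" "xs ! i = 0" using set by (metis in_set_conv_nth insertI1)
      then show ?thesis using sorted_nth_mono[OF sorted, of 0 i] by simp
    qed
    moreover have "0 \<le> xs ! 0" using nth_mem[OF len] set assms by auto
    ultimately show "\<tau> 0 = 0" by (simp add: \<tau>_def)
    show "J \<subseteq> \<tau> ` {..<length xs}"
    proof
      fix x assume "x \<in> J"
      then obtain i where "i < length xs" "xs ! i = x" using set by (metis in_set_conv_nth insertI2)
      then show "x \<in> \<tau> ` {..<length xs}" by (intro image_eqI[of _ _ i]) (auto simp: \<tau>_def)
    qed
    show "0 < length xs" by fact
  qed
qed

lemma mono_diff_eq_sum:
  fixes f :: "nat \<Rightarrow> nat"
  assumes "mono f" "m \<le> k"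
  shows "f k - f m = (\<Sum>i=m..<k. f (Suc i) - f i)"
  using assms(2)
proof (induction k rule: dec_induct)
  case base
  then show ?case by simp
next
  case (step k)
  then show ?case using monoD[OF assms(1), of m k] monoD[OF assms(1), of k "Suc k"] by simp
qed

lemma poisson_process_path:
  assumes "poisson_process M r N" "\<omega> \<in> space M"
  shows "counting_path (\<lambda>t. N t \<omega>)"
  using assms by (auto simp: poisson_process_def counting_path_def)

lemma poisson_process_measurable:
  assumes "poisson_process M r N" "0 \<le> t"
  shows "N t \<in> measurable M (count_space UNIV)"
  using assms by (auto simp: poisson_process_def)

lemma poisson_process_increment_law:
  assumes N: "poisson_process M r N" and "0 \<le> s" "0 \<le> t" "t \<le> u"
  shows "distr M (count_space UNIV) (\<lambda>\<omega>. N (s + u) \<omega> - N (s + t) \<omega>) =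
    distr M (count_space UNIV) (\<lambda>\<omega>. N u \<omega> - N t \<omega>)"
\<comment> \<open>The law is given for proper intervals only. A grid may repeat a time, and then
  both increments vanish.\<close>
proof (cases "t = u")
  case True
  then show ?thesis by simp
next
  case False
  have law: "distr M (count_space UNIV) (\<lambda>\<omega>. N b \<omega> - N a \<omega>) = measure_pmf (poisson_pmf (r * (b - a)))"
    if "0 \<le> a" "a < b" for a b using N that unfolding poisson_process_def by blast
  show ?thesis using False assms by (subst (1 2) law) auto
qed

context prob_space
begin

text \<open>Measures on the product space agree once they agree on cylinders. A cylinder is a
  condition on the increments along a grid, and their joint law is a product that does not depend on
  \<open>s\<close>.\<close>

lemma poisson_process_shift_law:
  assumes N: "poisson_process M r N" and s: "0 \<le> s"
  shows "distr M (path_space {0..}) (\<lambda>\<omega>. \<lambda>t\<in>{0..}. N (s + t) \<omega> - N s \<omega>) =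
    distr M (path_space {0..}) (\<lambda>\<omega>. \<lambda>t\<in>{0..}. N t \<omega>)"
proof -
  define Y where "Y s \<omega> = (\<lambda>t\<in>{0..}. N (s + t) \<omega> - N s \<omega>)" for s \<omega>
  note [measurable] = poisson_process_measurable[OF N]
  have Y_meas: "Y s \<in> measurable M (path_space {0..})" if "0 \<le> s" for s
    unfolding Y_def using that by (intro measurable_restrict) simp
  \<comment> \<open>The path vanishes at time 0, so the unshifted increments are the process
    itself.\<close>
  have Y0: "Y 0 \<omega> = (\<lambda>t\<in>{0..}. N t \<omega>)" if "\<omega> \<in> space M" for \<omega>
    using poisson_process_path[OF N that] by (auto simp: Y_def counting_path_def)
  have "distr M (path_space {0..}) (Y s) = distr M (path_space {0..}) (Y 0)"
  proof (rule measure_eqI_PiM_infinite)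
    show "finite_measure (distr M (path_space {0..}) (Y s))"
      by (intro finite_measure_distr Y_meas s)
    fix A :: "real \<Rightarrow> nat set" and J :: "real set" assume J: "finite J" "J \<subseteq> {0..}"
    obtain \<tau> :: "nat \<Rightarrow> real" and n where \<tau>: "\<tau> 0 = 0" "mono \<tau>" "J \<subseteq> \<tau> ` {..<n}" "0 < n"
      using finite_time_grid[OF J] by metis
    have \<tau>0: "0 \<le> \<tau> i" for i using monoD[OF \<tau>(2), of 0 i] \<tau>(1) by simp
    obtain k where k: "\<And>j. j \<in> J \<Longrightarrow> \<tau> (k j) = j \<and> k j < n"
    proof -
      have "\<forall>j\<in>J. \<exists>i. \<tau> i = j \<and> i < n" using \<tau>(3) by blast
      then show thesis using that by metis
    qed
    define inc where "inc s i \<omega> = N (s + \<tau> (Suc i)) \<omega> - N (s + \<tau> i) \<omega>" for s i \<omega>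
    have inc_meas [measurable]: "inc s i \<in> measurable M (count_space UNIV)" if "0 \<le> s" for s i
    proof -
      have [measurable]: "N (s + \<tau> i) \<in> measurable M (count_space UNIV)" for i
        using that \<tau>0 by (intro poisson_process_measurable[OF N]) simp
      show ?thesis unfolding inc_def by measurable
    qed
    let ?C = "PiM {..<n} (\<lambda>_. count_space (UNIV :: nat set))"
    have law: "distr M ?C (\<lambda>\<omega>. \<lambda>i\<in>{..<n}. inc s i \<omega>) = PiM {..<n} (\<lambda>i. distr M (count_space UNIV) (inc 0 i))"
      if s: "0 \<le> s" for s
    proof -
      have "indep_vars (\<lambda>_. count_space UNIV) (inc s) {..<n}"
        using N[unfolded poisson_process_def, THEN conjunct2, THEN conjunct2, THEN conjunct2,
            rule_format, of "\<lambda>i. s + \<tau> i" n] s \<tau>0 monoD[OF \<tau>(2)]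
        by (auto simp: mono_def inc_def[abs_def])
      then have "distr M ?C (\<lambda>\<omega>. \<lambda>i\<in>{..<n}. inc s i \<omega>) = PiM {..<n} (\<lambda>i. distr M (count_space UNIV) (inc s i))"
        using \<tau>(4) s by (subst (asm) indep_vars_iff_distr_eq_PiM') auto
      moreover have "distr M (count_space UNIV) (inc s i) = distr M (count_space UNIV) (inc 0 i)" for i
        unfolding inc_def[abs_def]
        using poisson_process_increment_law[OF N s \<tau>0 monoD[OF \<tau>(2)], of i "Suc i"] by simp
      ultimately show ?thesis by simp
    qed
    \<comment> \<open>The cylinder in terms of increments: the value at time \<open>j\<close>, which
      is grid time number \<open>k j\<close>, is the sum of the first \<open>k j\<close>
      increments.\<close>
    define B where "B = {x\<in>space ?C. \<forall>j\<in>J. (\<Sum>i=0..<k j. x i) \<in> A j}"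
    have B: "B \<in> sets ?C"
    proof -
      have "(\<lambda>x. \<Sum>i=0..<k j. x i) \<in> measurable ?C (count_space UNIV)" if "j \<in> J" for j
        using k[OF that] by (intro measurable_sum_nat measurable_component_singleton) auto
      then have "Measurable.pred ?C (\<lambda>x. \<forall>j\<in>J. (\<Sum>i=0..<k j. x i) \<in> A j)"
        using J(1) by (intro pred_intros_finite) (auto intro: measurable_compose)
      then show ?thesis by (simp add: B_def pred_def)
    qed
    have Y_eq: "Y s -` prod_emb {0..} (\<lambda>_. count_space UNIV) J (Pi\<^sub>E J A) \<inter> space M =
        (\<lambda>\<omega>. \<lambda>i\<in>{..<n}. inc s i \<omega>) -` B \<inter> space M" if s: "0 \<le> s" for s
    proof -
      have sum: "(\<Sum>i=0..<k j. (\<lambda>i\<in>{..<n}. inc s i \<omega>) i) = Y s \<omega> j" if "j \<in> J" "\<omega> \<in> space M" for j \<omega>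
      proof -
        have "mono (\<lambda>i. N (s + \<tau> i) \<omega>)"
          using counting_path_mono[OF poisson_process_path[OF N that(2)]] s \<tau>0 monoD[OF \<tau>(2)]
          by (intro monoI) auto
        from mono_diff_eq_sum[OF this, of 0 "k j"] have "Y s \<omega> j = (\<Sum>i=0..<k j. inc s i \<omega>)"
          using k[OF that(1)] J that \<tau>(1) by (auto simp: Y_def inc_def)
        also have "\<dots> = (\<Sum>i=0..<k j. (\<lambda>i\<in>{..<n}. inc s i \<omega>) i)"
          using k[OF that(1)] by (intro sum.cong) auto
        finally show ?thesis by simp
      qed
      have "\<omega> \<in> Y s -` prod_emb {0..} (\<lambda>_. count_space UNIV) J (Pi\<^sub>E J A) \<longleftrightarrow> (\<forall>j\<in>J. Y s \<omega> j \<in> A j)" for \<omega>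
        using J by (auto simp: prod_emb_def PiE_iff Y_def)
      moreover have "\<omega> \<in> (\<lambda>\<omega>. \<lambda>i\<in>{..<n}. inc s i \<omega>) -` B \<longleftrightarrow> (\<forall>j\<in>J. Y s \<omega> j \<in> A j)" if "\<omega> \<in> space M" for \<omega>
        using sum[OF _ that] by (simp add: B_def space_PiM)
      ultimately show ?thesis by auto
    qed
    have emb: "prod_emb {0..} (\<lambda>_. count_space UNIV) J (Pi\<^sub>E J A) \<in> sets (path_space {0..})"
      using J by (intro sets_PiM_I) auto
    have "emeasure (distr M (path_space {0..}) (Y s)) (prod_emb {0..} (\<lambda>_. count_space UNIV) J (Pi\<^sub>E J A)) =
        emeasure (PiM {..<n} (\<lambda>i. distr M (count_space UNIV) (inc 0 i))) B" if s: "0 \<le> s" for s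
    proof -
      have "(\<lambda>\<omega>. \<lambda>i\<in>{..<n}. inc s i \<omega>) \<in> measurable M ?C" using s by (intro measurable_restrict) simp
      then show ?thesis
        unfolding law[OF s, symmetric] using Y_meas[OF s] emb B Y_eq[OF s] by (simp add: emeasure_distr)
    qed
    from this[OF s] this[of 0]
    show "emeasure (distr M (path_space {0..}) (Y s)) (prod_emb {0..} (\<lambda>_. count_space UNIV) J (Pi\<^sub>E J A)) =
        emeasure (distr M (path_space {0..}) (Y 0)) (prod_emb {0..} (\<lambda>_. count_space UNIV) J (Pi\<^sub>E J A))"
      by simp
  qed auto
  also have "distr M (path_space {0..}) (Y 0) = distr M (path_space {0..}) (\<lambda>\<omega>. \<lambda>t\<in>{0..}. N t \<omega>)"
    using Y0 by (intro distr_cong) auto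
  finally show ?thesis by (simp add: Y_def[abs_def])
qed

text \<open>With \<open>s\<close> at index \<open>m\<close> of the grid, the stopped path depends on
  the increments below \<open>m\<close> and the shifted path on those from \<open>m\<close> on;
  these two blocks are independent.\<close>

lemma poisson_process_indep_past_future:
  assumes N: "poisson_process M r N" and s: "0 \<le> s"
  shows "indep_var (path_space {0..}) (\<lambda>\<omega>. \<lambda>t\<in>{0..}. N (min t s) \<omega>)
     (path_space {0..}) (\<lambda>\<omega>. \<lambda>t\<in>{0..}. N (s + t) \<omega> - N s \<omega>)"
proof (rule indep_var_PiM)
  note meas [measurable] = poisson_process_measurable[OF N]
  show "(\<lambda>\<omega>. \<lambda>t\<in>{0..}. N (min t s) \<omega>) \<in> measurable M (path_space {0..})"
    "(\<lambda>\<omega>. \<lambda>t\<in>{0..}. N (s + t) \<omega> - N s \<omega>) \<in> measurable M (path_space {0..})"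
    using s by (auto intro!: measurable_restrict)
  fix J L :: "real set" and A B :: "real \<Rightarrow> nat set"
  assume J: "finite J" "J \<subseteq> {0..}" and L: "finite L" "L \<subseteq> {0..}"
  let ?J = "insert s ((\<lambda>j. min j s) ` J \<union> (\<lambda>l. s + l) ` L)"
  have "finite ?J" "?J \<subseteq> {0..}" using J L s by auto
  then obtain \<tau> :: "nat \<Rightarrow> real" and n where \<tau>: "\<tau> 0 = 0" "mono \<tau>" "?J \<subseteq> \<tau> ` {..<n}" "0 < n"
    by (rule finite_time_grid)
  have \<tau>0: "0 \<le> \<tau> i" for i using monoD[OF \<tau>(2), of 0 i] \<tau>(1) by simp
  obtain m where m: "\<tau> m = s" "m < n" using \<tau>(3) by auto
  \<comment> \<open>The grid may repeat \<open>s\<close>. An index that falls on the wrong side of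
    \<open>m\<close> still belongs to the time \<open>s\<close> and is replaced by
    \<open>m\<close>.\<close>
  have "\<forall>j\<in>J. \<exists>i\<le>m. \<tau> i = min j s"
  proof
    fix j assume "j \<in> J"
    then obtain i where i: "\<tau> i = min j s" using \<tau>(3) by auto
    show "\<exists>i\<le>m. \<tau> i = min j s"
    proof (cases "i \<le> m")
      case False
      then have "s \<le> \<tau> i" using monoD[OF \<tau>(2), of m i] m by simp
      then show ?thesis using i m by (intro exI[of _ m]) auto
    qed (use i in auto)
  qed
  then obtain k where k: "\<And>j. j \<in> J \<Longrightarrow> k j \<le> m \<and> \<tau> (k j) = min j s" by metis
  have "\<forall>l\<in>L. \<exists>i\<ge>m. i < n \<and> \<tau> i = s + l"
  proof
    fix l assume l: "l \<in> L"
    then obtain i where i: "\<tau> i = s + l" "i < n" using \<tau>(3) by auto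
    show "\<exists>i\<ge>m. i < n \<and> \<tau> i = s + l"
    proof (cases "m \<le> i")
      case False
      then have "\<tau> i \<le> s" using monoD[OF \<tau>(2), of i m] m by simp
      then show ?thesis using i m l L by (intro exI[of _ m]) auto
    qed (use i in auto)
  qed
  then obtain h where h: "\<And>l. l \<in> L \<Longrightarrow> m \<le> h l \<and> h l < n \<and> \<tau> (h l) = s + l" by metis
  define inc where "inc i \<omega> = N (\<tau> (Suc i)) \<omega> - N (\<tau> i) \<omega>" for i \<omega>
  let ?C = "\<lambda>I. PiM I (\<lambda>_. count_space (UNIV :: nat set))"
  have "indep_vars (\<lambda>_. count_space UNIV) inc {..<n}"
    using N[unfolded poisson_process_def, THEN conjunct2, THEN conjunct2, THEN conjunct2,
            rule_format, of \<tau> n] \<tau>0 \<tau>(2) by (simp add: inc_def[abs_def])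
  then have ind: "indep_var (?C {..<m}) (\<lambda>\<omega>. \<lambda>i\<in>{..<m}. inc i \<omega>) (?C {m..<n}) (\<lambda>\<omega>. \<lambda>i\<in>{m..<n}. inc i \<omega>)"
    using m by (intro indep_var_restrict) auto
  have set_meas: "{x\<in>space (?C I). \<forall>j\<in>J. (\<Sum>i=a..<k j. x i) \<in> A j} \<in> sets (?C I)"
    if "finite J" "\<And>j. j \<in> J \<Longrightarrow> {a..<k j} \<subseteq> I" for a I k A and J :: "real set"
  proof -
    have "(\<lambda>x. \<Sum>i=a..<k j. x i) \<in> measurable (?C I) (count_space UNIV)" if "j \<in> J" for j
      using \<open>\<And>j. j \<in> J \<Longrightarrow> {a..<k j} \<subseteq> I\<close>[OF that]
      by (intro measurable_sum_nat measurable_component_singleton) auto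
    then have "Measurable.pred (?C I) (\<lambda>x. \<forall>j\<in>J. (\<Sum>i=a..<k j. x i) \<in> A j)"
      using that(1) by (intro pred_intros_finite) (auto intro: measurable_compose)
    then show ?thesis by (simp add: pred_def)
  qed
  let ?A = "{x\<in>space (?C {..<m}). \<forall>j\<in>J. (\<Sum>i=0..<k j. x i) \<in> A j}"
  let ?B = "{x\<in>space (?C {m..<n}). \<forall>l\<in>L. (\<Sum>i=m..<h l. x i) \<in> B l}"
  have sets: "?A \<in> sets (?C {..<m})" "?B \<in> sets (?C {m..<n})"
    by (rule set_meas, use k J in fastforce, use k in fastforce) (rule set_meas, use L in fastforce, use h in fastforce)
  have mono: "mono (\<lambda>i. N (\<tau> i) \<omega>)" if "\<omega> \<in> space M" for \<omega>
    using counting_path_mono[OF poisson_process_path[OF N that]] \<tau>0 monoD[OF \<tau>(2)]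
    by (intro monoI) auto
  have past: "(\<lambda>\<omega>. \<lambda>i\<in>{..<m}. inc i \<omega>) -` ?A \<inter> space M =
      {\<omega>\<in>space M. \<forall>j\<in>J. (\<lambda>t\<in>{0..}. N (min t s) \<omega>) j \<in> A j}"
  proof -
    have "(\<Sum>i=0..<k j. (\<lambda>i\<in>{..<m}. inc i \<omega>) i) = (\<lambda>t\<in>{0..}. N (min t s) \<omega>) j"
      if "j \<in> J" "\<omega> \<in> space M" for j \<omega>
    proof -
      have "(\<Sum>i=0..<k j. (\<lambda>i\<in>{..<m}. inc i \<omega>) i) = (\<Sum>i=0..<k j. inc i \<omega>)"
        using k[OF that(1)] by (intro sum.cong) auto
      also have "\<dots> = N (\<tau> (k j)) \<omega> - N (\<tau> 0) \<omega>"
        using mono_diff_eq_sum[OF mono[OF that(2)], of 0 "k j"] by (simp add: inc_def)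
      finally show ?thesis
        using k[OF that(1)] \<tau>(1) poisson_process_path[OF N that(2)] J that
        by (auto simp: counting_path_def)
    qed
    then show ?thesis by (auto simp: space_PiM)
  qed
  have fut: "(\<lambda>\<omega>. \<lambda>i\<in>{m..<n}. inc i \<omega>) -` ?B \<inter> space M =
      {\<omega>\<in>space M. \<forall>l\<in>L. (\<lambda>t\<in>{0..}. N (s + t) \<omega> - N s \<omega>) l \<in> B l}"
  proof -
    have "(\<Sum>i=m..<h l. (\<lambda>i\<in>{m..<n}. inc i \<omega>) i) = (\<lambda>t\<in>{0..}. N (s + t) \<omega> - N s \<omega>) l"
      if "l \<in> L" "\<omega> \<in> space M" for l \<omega>
    proof -
      have "(\<Sum>i=m..<h l. (\<lambda>i\<in>{m..<n}. inc i \<omega>) i) = (\<Sum>i=m..<h l. inc i \<omega>)"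
        using h[OF that(1)] by (intro sum.cong) auto
      also have "\<dots> = N (\<tau> (h l)) \<omega> - N (\<tau> m) \<omega>"
        using mono_diff_eq_sum[OF mono[OF that(2)], of m "h l"] h[OF that(1)] by (simp add: inc_def)
      finally show ?thesis
        using h[OF that(1)] m L that by auto
    qed
    then show ?thesis by (auto simp: space_PiM)
  qed
  have "{\<omega>\<in>space M. (\<forall>j\<in>J. (\<lambda>t\<in>{0..}. N (min t s) \<omega>) j \<in> A j) \<and>
      (\<forall>l\<in>L. (\<lambda>t\<in>{0..}. N (s + t) \<omega> - N s \<omega>) l \<in> B l)} =
      (\<lambda>\<omega>. (\<lambda>i\<in>{..<m}. inc i \<omega>, \<lambda>i\<in>{m..<n}. inc i \<omega>)) -` (?A \<times> ?B) \<inter> space M"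
    using past fut by blast
  then show "prob {\<omega>\<in>space M. (\<forall>j\<in>J. (\<lambda>t\<in>{0..}. N (min t s) \<omega>) j \<in> A j) \<and>
      (\<forall>l\<in>L. (\<lambda>t\<in>{0..}. N (s + t) \<omega> - N s \<omega>) l \<in> B l)} =
     prob {\<omega>\<in>space M. \<forall>j\<in>J. (\<lambda>t\<in>{0..}. N (min t s) \<omega>) j \<in> A j} *
     prob {\<omega>\<in>space M. \<forall>l\<in>L. (\<lambda>t\<in>{0..}. N (s + t) \<omega> - N s \<omega>) l \<in> B l}"
    using indep_varD[OF ind sets] past fut by simp
qed

end

text \<open>Independence across the index set and independence of two functions of each single
  variable combine into joint independence of all the pieces. It is meant for the past and the
  future of each clock, which can afterwards be regrouped.\<close>

lemma (in prob_space) indep_vars_times_bool: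
  assumes X: "indep_vars (\<lambda>_. S) X I"
    and f: "\<And>b. f b \<in> measurable S T"
    and ind: "\<And>i. i \<in> I \<Longrightarrow> indep_var T (\<lambda>\<omega>. f True (X i \<omega>)) T (\<lambda>\<omega>. f False (X i \<omega>))"
  shows "indep_vars (\<lambda>_. T) (\<lambda>(i, b) \<omega>. f b (X i \<omega>)) (I \<times> UNIV)"
proof -
  have X_meas: "X i \<in> measurable M S" if "i \<in> I" for i
    using X that by (auto simp: indep_vars_def2)
  define Y where "Y = (\<lambda>(i, b) \<omega>. f b (X i \<omega>))"
  have Y_meas: "Y j \<in> measurable M T" if "j \<in> I \<times> UNIV" for j
    using that f X_meas by (auto simp: Y_def intro: measurable_compose)
  have "indep_sets (\<lambda>j. {Y j -` A \<inter> space M |A. A \<in> sets T}) (I \<times> UNIV)"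
  proof (rule indep_setsI)
    show "{Y j -` A \<inter> space M |A. A \<in> sets T} \<subseteq> events" if "j \<in> I \<times> UNIV" for j
      using measurable_sets[OF Y_meas[OF that]] by auto
  next
    fix A J
    assume J: "J \<noteq> {}" "J \<subseteq> I \<times> UNIV" "finite J"
      and A: "\<forall>j\<in>J. A j \<in> {Y j -` A \<inter> space M |A. A \<in> sets T}"
    have "\<forall>j\<in>J. \<exists>B. A j = Y j -` B \<inter> space M \<and> B \<in> sets T" using A by simp
    then obtain B where B: "\<forall>j\<in>J. A j = Y j -` B j \<inter> space M \<and> B j \<in> sets T" by (rule bchoice[THEN exE])
    \<comment> \<open>A missing half gets the trivial constraint \<open>space T\<close>, so that
      both halves at \<open>i\<close> form one event \<open>D i\<close> for \<open>X i\<close>; the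
      added factors are 1 and disappear again at the end.\<close>
    define B' where "B' j = (if j \<in> J then B j else space T)" for j
    have B': "B' j \<in> sets T" for j using B by (auto simp: B'_def)
    define K where "K = fst ` J"
    have K: "K \<noteq> {}" "finite K" "K \<subseteq> I" "J \<subseteq> K \<times> UNIV" using J by (force simp: K_def)+
    define P where "P j = prob (Y j -` B' j \<inter> space M)" for j
    define D where "D i = {x\<in>space S. f True x \<in> B' (i, True) \<and> f False x \<in> B' (i, False)}" for i
    have D: "D i \<in> sets S" for i
    proof -
      have "D i = (f True -` B' (i, True) \<inter> space S) \<inter> (f False -` B' (i, False) \<inter> space S)"
        by (auto simp: D_def)
      then show ?thesis using measurable_sets[OF f B'] by (metis sets.Int)
    qed
    have "(\<Inter>j\<in>J. A j) = (\<Inter>i\<in>K. X i -` D i \<inter> space M)"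
    proof (intro equalityI subsetI)
      fix \<omega> assume \<omega>: "\<omega> \<in> (\<Inter>j\<in>J. A j)"
      then have sp: "\<omega> \<in> space M" and YB: "\<And>j. j \<in> J \<Longrightarrow> Y j \<omega> \<in> B j" using J(1) B by auto
      have "Y (i, b) \<omega> \<in> B' (i, b)" if "i \<in> K" for i b
        using YB[of "(i, b)"] measurable_space[OF Y_meas sp, of "(i, b)"] that K(3) by (auto simp: B'_def)
      then show "\<omega> \<in> (\<Inter>i\<in>K. X i -` D i \<inter> space M)"
        using measurable_space[OF X_meas sp] sp K(3) by (auto simp: D_def Y_def)
    next
      fix \<omega> assume \<omega>: "\<omega> \<in> (\<Inter>i\<in>K. X i -` D i \<inter> space M)"
      show "\<omega> \<in> (\<Inter>j\<in>J. A j)"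
      proof
        fix j assume j: "j \<in> J"
        obtain i b where ib: "j = (i, b)" by (cases j)
        have "i \<in> K" using j ib K(4) by auto
        then have sp: "\<omega> \<in> space M" and "X i \<omega> \<in> D i" using \<omega> by blast+
        then have "f b (X i \<omega>) \<in> B' (i, b)" by (cases b) (simp_all add: D_def)
        then have "Y j \<omega> \<in> B j" using j ib by (simp add: B'_def Y_def)
        then show "\<omega> \<in> A j" using B j sp by blast
      qed
    qed
    then have "prob (\<Inter>j\<in>J. A j) = (\<Prod>i\<in>K. prob (X i -` D i \<inter> space M))"
      using indep_varsD[OF X K(1,2,3) D] by simp
    also have "\<dots> = (\<Prod>i\<in>K. \<Prod>b\<in>UNIV. P (i, b))"
    proof (rule prod.cong[OF refl])
      fix i assume "i \<in> K"
      then have i: "i \<in> I" using K by auto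
      have "X i -` D i \<inter> space M =
          (\<lambda>\<omega>. (f True (X i \<omega>), f False (X i \<omega>))) -` (B' (i, True) \<times> B' (i, False)) \<inter> space M"
        using measurable_space[OF X_meas[OF i]] by (auto simp: D_def)
      then have "prob (X i -` D i \<inter> space M) = P (i, True) * P (i, False)"
        using indep_varD[OF ind[OF i] B' B'] by (simp add: P_def Y_def)
      then show "prob (X i -` D i \<inter> space M) = (\<Prod>b\<in>UNIV. P (i, b))" by (simp add: UNIV_bool)
    qed
    also have "\<dots> = (\<Prod>j\<in>K \<times> UNIV. P j)" by (simp add: prod.cartesian_product)
    also have "\<dots> = (\<Prod>j\<in>J. P j)"
    proof (rule prod.mono_neutral_right)
      show "\<forall>j\<in>K \<times> UNIV - J. P j = 1"
      proof
        fix j assume j: "j \<in> K \<times> UNIV - J"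
        then have "Y j -` B' j \<inter> space M = space M"
          using measurable_space[OF Y_meas, of j] K(3) by (auto simp: B'_def)
        then show "P j = 1" by (simp add: P_def prob_space)
      qed
    qed (use K in auto)
    also have "\<dots> = (\<Prod>j\<in>J. prob (A j))"
      using B by (intro prod.cong) (auto simp: P_def B'_def)
    finally show "prob (\<Inter>j\<in>J. A j) = (\<Prod>j\<in>J. prob (A j))" .
  qed
  then show ?thesis using Y_meas unfolding indep_vars_def2 Y_def by simp
qed

section \<open>The walk on its graph, and the Markov property for all clocks together\<close>

locale coalescing_walk = prob_space M
  for M :: "'a measure" +
  fixes G :: "'v pair_pre_digraph" and N :: "'v \<times> 'v \<Rightarrow> real \<Rightarrow> 'a \<Rightarrow> nat"
  assumes bidirected: "pair_bidirected_digraph G"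
    and connected: "connected_graph G"
    and locally_finite: "locally_finite_graph G"
    and clocks: "poisson_clocks M G N"
begin

lemma wf: "pair_wf_digraph G"
  using bidirected by (simp add: pair_bidirected_digraph_def pair_loopfree_digraph_def)

lemma finite_out_arcs: "finite (out_arcs (with_proj G) v)"
proof (cases "v \<in> pverts G")
  case True
  then show ?thesis using locally_finite by (auto simp: locally_finite_graph_def)
next
  case False
  then have "out_arcs (with_proj G) v = {}"
    using pair_wf_digraph.arc_fst_in_verts[OF wf] by (auto simp: out_arcs_def)
  then show ?thesis by simp
qed

lemma verts_nonempty: "pverts G \<noteq> {}"
  using connected by (auto simp: connected_graph_def connected_conv)

lemma arc_path:
  assumes "u \<in> pverts G" "v \<in> pverts G"
  shows "(u, v) \<in> (parcs G)\<^sup>*"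
proof -
  have "sym (parcs G)"
    using bidirected
    by (auto simp: pair_bidirected_digraph_def pair_sym_digraph_def pair_sym_digraph_axioms_def symmetric_def)
  then have "(parcs G)\<^sup>s = parcs G" by (auto simp: symcl_def sym_def)
  then have "(u, v) \<in> rtrancl_on (pverts G) (parcs G)"
    using connected assms by (simp add: connected_graph_def connected_conv)
  then show ?thesis
    by (induction rule: rtrancl_on.induct) (auto intro: rtrancl_into_rtrancl)
qed

text \<open>By local finiteness the endpoints of walks of length \<open>n\<close> from a fixed
  vertex form a finite set, and connectedness exhausts the vertices in this way. Countability makes
  occupation, a union over starting vertices and itineraries, an event.\<close>

lemma countable_verts: "countable (pverts G)"
proof -
  obtain v where v: "v \<in> pverts G" using verts_nonempty by blast
  define B where "B n = {w. (v, w) \<in> parcs G ^^ n}" for n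
  have "finite (B n)" for n
  proof (induction n)
    case 0
    then show ?case by (simp add: B_def)
  next
    case (Suc n)
    have "B (Suc n) \<subseteq> (\<Union>u\<in>B n. snd ` out_arcs (with_proj G) u)"
      by (force simp: B_def out_arcs_def)
    then show ?case using Suc finite_out_arcs by (auto intro: finite_subset)
  qed
  moreover have "pverts G \<subseteq> (\<Union>n. B n)"
    using arc_path[OF v] by (auto simp: B_def rtrancl_power)
  ultimately show ?thesis
    by (meson countable_UN countable_finite countable_subset countableI_type)
qed

lemma countable_arcs: "countable (parcs G)"
proof -
  have "parcs G \<subseteq> pverts G \<times> pverts G"
    using pair_wf_digraph.arc_fst_in_verts[OF wf] pair_wf_digraph.arc_snd_in_verts[OF wf] by force
  then show ?thesis using countable_verts by (meson countable_SIGMA countable_subset)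
qed

lemma clock_process: "e \<in> parcs G \<Longrightarrow> poisson_process M 1 (N e)"
  using clocks by (simp add: poisson_clocks_def)

lemma clock_path: "\<omega> \<in> space M \<Longrightarrow> e \<in> parcs G \<Longrightarrow> counting_path (\<lambda>t. N e t \<omega>)"
  by (rule poisson_process_path[OF clock_process])

abbreviation "arc_paths_space \<equiv> clock_space (parcs G)"

definition paths :: "'a \<Rightarrow> 'v \<times> 'v \<Rightarrow> real \<Rightarrow> nat" where
  "paths \<omega> = clock_paths (parcs G) (\<lambda>e t. N e t \<omega>)"

definition past :: "real \<Rightarrow> 'a \<Rightarrow> 'v \<times> 'v \<Rightarrow> real \<Rightarrow> nat" where
  "past s \<omega> = clock_paths (parcs G) (\<lambda>e t. N e (min t s) \<omega>)"

definition future :: "real \<Rightarrow> 'a \<Rightarrow> 'v \<times> 'v \<Rightarrow> real \<Rightarrow> nat" where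
  "future s \<omega> = clock_paths (parcs G) (\<lambda>e t. N e (s + t) \<omega> - N e s \<omega>)"

lemma measurable_clock_path: "e \<in> parcs G \<Longrightarrow> (\<lambda>\<omega>. \<lambda>t\<in>{0..}. N e t \<omega>) \<in> measurable M (path_space {0..})"
  by (intro measurable_restrict) (auto intro: poisson_process_measurable[OF clock_process])

text \<open>Each clock is split into its stopped path, tagged \<open>True\<close>, and its
  increments after \<open>s\<close>, tagged \<open>False\<close>. All these pieces are jointly
  independent, so collecting them by tag gives two independent families.\<close>

lemma indep_past_future:
  assumes s: "0 \<le> s"
  shows "indep_var arc_paths_space (past s) arc_paths_space (future s)"
proof -
  define f :: "bool \<Rightarrow> (real \<Rightarrow> nat) \<Rightarrow> real \<Rightarrow> nat"
    where "f b z = (\<lambda>t\<in>{0..}. if b then z (min t s) else z (s + t) - z s)" for b z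
  have f: "f b \<in> measurable (path_space {0..}) (path_space {0..})" for b
    unfolding f_def using s by (cases b) (auto intro!: measurable_restrict)
  let ?X = "\<lambda>e \<omega>. \<lambda>t\<in>{0..}. N e t \<omega>"
  have fX: "f True (?X e \<omega>) = (\<lambda>t\<in>{0..}. N e (min t s) \<omega>)"
    "f False (?X e \<omega>) = (\<lambda>t\<in>{0..}. N e (s + t) \<omega> - N e s \<omega>)" for e \<omega>
    using s by (auto simp: f_def)
  have "indep_vars (\<lambda>_. path_space {0..}) ?X (parcs G)"
    using clocks by (simp add: poisson_clocks_def)
  then have "indep_vars (\<lambda>_. path_space {0..}) (\<lambda>(e, b) \<omega>. f b (?X e \<omega>)) (parcs G \<times> UNIV)"
    by (rule indep_vars_times_bool[OF _ f])
      (simp only: fX poisson_process_indep_past_future[OF clock_process s])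
  then have ind: "indep_var (PiM (parcs G \<times> {True}) (\<lambda>_. path_space {0..}))
      (\<lambda>\<omega>. \<lambda>j\<in>parcs G \<times> {True}. (\<lambda>(e, b) \<omega>. f b (?X e \<omega>)) j \<omega>)
      (PiM (parcs G \<times> {False}) (\<lambda>_. path_space {0..}))
      (\<lambda>\<omega>. \<lambda>j\<in>parcs G \<times> {False}. (\<lambda>(e, b) \<omega>. f b (?X e \<omega>)) j \<omega>)"
    by (rule indep_var_restrict) auto
  have sel: "(\<lambda>g. \<lambda>e\<in>parcs G. g (e, b)) \<in>
      measurable (PiM (parcs G \<times> {b}) (\<lambda>_. path_space {0..})) arc_paths_space" for b :: bool
    by (intro measurable_restrict measurable_component_singleton) auto
  have "indep_var arc_paths_space
      ((\<lambda>g. \<lambda>e\<in>parcs G. g (e, True)) \<circ> (\<lambda>\<omega>. \<lambda>j\<in>parcs G \<times> {True}. (\<lambda>(e, b) \<omega>. f b (?X e \<omega>)) j \<omega>))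
      arc_paths_space
      ((\<lambda>g. \<lambda>e\<in>parcs G. g (e, False)) \<circ> (\<lambda>\<omega>. \<lambda>j\<in>parcs G \<times> {False}. (\<lambda>(e, b) \<omega>. f b (?X e \<omega>)) j \<omega>))"
    by (rule indep_var_compose[OF ind sel sel])
  also have "(\<lambda>g. \<lambda>e\<in>parcs G. g (e, True)) \<circ> (\<lambda>\<omega>. \<lambda>j\<in>parcs G \<times> {True}. (\<lambda>(e, b) \<omega>. f b (?X e \<omega>)) j \<omega>) = past s"
    unfolding past_def clock_paths_def comp_def by (intro ext restrict_ext) (simp add: fX)
  also have "(\<lambda>g. \<lambda>e\<in>parcs G. g (e, False)) \<circ> (\<lambda>\<omega>. \<lambda>j\<in>parcs G \<times> {False}. (\<lambda>(e, b) \<omega>. f b (?X e \<omega>)) j \<omega>) = future s"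
    unfolding future_def clock_paths_def comp_def by (intro ext restrict_ext) (simp add: fX)
  finally show ?thesis .
qed

lemma indep_future_clocks:
  assumes s: "0 \<le> s"
  shows "indep_vars (\<lambda>_. path_space {0..}) (\<lambda>e \<omega>. \<lambda>t\<in>{0..}. N e (s + t) \<omega> - N e s \<omega>) (parcs G)"
proof -
  define g :: "(real \<Rightarrow> nat) \<Rightarrow> real \<Rightarrow> nat" where "g z = (\<lambda>t\<in>{0..}. z (s + t) - z s)" for z
  have g: "g \<in> measurable (path_space {0..}) (path_space {0..})"
    unfolding g_def using s by (auto intro!: measurable_restrict)
  have "indep_vars (\<lambda>_. path_space {0..}) (\<lambda>e \<omega>. \<lambda>t\<in>{0..}. N e t \<omega>) (parcs G)"
    using clocks by (simp add: poisson_clocks_def)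
  then have "indep_vars (\<lambda>_. path_space {0..}) (\<lambda>e \<omega>. g (\<lambda>t\<in>{0..}. N e t \<omega>)) (parcs G)"
    by (rule indep_vars_compose2) (rule g)
  moreover have "g (\<lambda>t\<in>{0..}. N e t \<omega>) = (\<lambda>t\<in>{0..}. N e (s + t) \<omega> - N e s \<omega>)" for e \<omega>
    unfolding g_def using s by (intro restrict_ext) simp
  ultimately show ?thesis by (simp only:)
qed

lemma measurable_past: "0 \<le> s \<Longrightarrow> past s \<in> measurable M arc_paths_space"
  and measurable_future: "0 \<le> s \<Longrightarrow> future s \<in> measurable M arc_paths_space"
  using indep_past_future by (auto simp: indep_var_eq)

lemma measurable_paths: "paths \<in> measurable M arc_paths_space"
  unfolding paths_def clock_paths_def by (intro measurable_restrict measurable_clock_path)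

text \<open>Both laws are products over the arcs, and their factors agree by stationarity of a
  single clock.\<close>

lemma distr_future:
  assumes s: "0 \<le> s"
  shows "distr M arc_paths_space (future s) = distr M arc_paths_space paths"
\<comment> \<open>The description of independence by product laws is for nonempty index sets;
  without arcs both families of paths are trivial.\<close>
proof (cases "parcs G = {}")
  case True
  then have "future s = paths"
    by (intro ext) (simp add: future_def paths_def clock_paths_def)
  then show ?thesis by simp
next
  case False
  define Z where "Z e \<omega> = (\<lambda>t\<in>{0..}. N e t \<omega>)" for e \<omega>
  define F where "F e \<omega> = (\<lambda>t\<in>{0..}. N e (s + t) \<omega> - N e s \<omega>)" for e \<omega>
  have Z: "indep_vars (\<lambda>_. path_space {0..}) Z (parcs G)"
    using clocks by (simp add: poisson_clocks_def Z_def[abs_def])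
  have F: "indep_vars (\<lambda>_. path_space {0..}) F (parcs G)"
    using indep_future_clocks[OF s] by (simp add: F_def[abs_def])
  have law: "distr M arc_paths_space (\<lambda>\<omega>. \<lambda>e\<in>parcs G. X e \<omega>) = PiM (parcs G) (\<lambda>e. distr M (path_space {0..}) (X e))"
    if "indep_vars (\<lambda>_. path_space {0..}) X (parcs G)" for X
    using that
    by (subst (asm) indep_vars_iff_distr_eq_PiM'[OF False])
       (use that in \<open>simp_all add: indep_vars_def2\<close>)
  have "future s = (\<lambda>\<omega>. \<lambda>e\<in>parcs G. F e \<omega>)"
    by (intro ext) (simp add: future_def clock_paths_def F_def)
  moreover have "paths = (\<lambda>\<omega>. \<lambda>e\<in>parcs G. Z e \<omega>)"
    by (intro ext) (simp add: paths_def clock_paths_def Z_def)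
  moreover have "PiM (parcs G) (\<lambda>e. distr M (path_space {0..}) (F e)) = PiM (parcs G) (\<lambda>e. distr M (path_space {0..}) (Z e))"
    using poisson_process_shift_law[OF clock_process s] unfolding F_def[abs_def] Z_def[abs_def]
    by (intro PiM_cong) simp_all
  ultimately show ?thesis using law[OF Z] law[OF F] by (simp only:)
qed

lemma prob_future:
  assumes "0 \<le> s" "A \<in> sets arc_paths_space"
  shows "prob (future s -` A \<inter> space M) = prob (paths -` A \<inter> space M)"
proof -
  have "measure (distr M arc_paths_space (future s)) A = measure (distr M arc_paths_space paths) A"
    using distr_future[OF assms(1)] by simp
  then show ?thesis using assms measurable_future measurable_paths by (simp add: measure_distr)
qed

lemma prob_past_future:
  assumes "0 \<le> s" "A \<in> sets arc_paths_space" "B \<in> sets arc_paths_space"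
  shows "prob ((past s -` A \<inter> space M) \<inter> (future s -` B \<inter> space M)) =
    prob (past s -` A \<inter> space M) * prob (future s -` B \<inter> space M)"
proof -
  have "(past s -` A \<inter> space M) \<inter> (future s -` B \<inter> space M) =
      (\<lambda>\<omega>. (past s \<omega>, future s \<omega>)) -` (A \<times> B) \<inter> space M" by auto
  then show ?thesis using indep_varD[OF indep_past_future[OF assms(1)] assms(2,3)] by simp
qed

end

section \<open>Series\<close>

text \<open>Summing the inequality bounds a partial sum \<open>s\<close> by
  \<open>a 0 + q * s\<close>, because a truncated convolution is at most the product of the partial
  sums. Since \<open>s\<close> is finite and \<open>q < 1\<close>, it can be absorbed, leaving the
  geometric bound \<open>a 0 / (1 - q)\<close>.\<close>

lemma renewal_summable:
  fixes a d :: "nat \<Rightarrow> real"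
  assumes a: "\<And>k. 0 \<le> a k" and d: "\<And>k. 0 \<le> d k"
    and renewal: "\<And>k. a (Suc k) \<le> (\<Sum>j\<le>k. d j * a (k - j))"
    and q: "\<And>n. (\<Sum>j<n. d j) \<le> q" "q < 1"
  shows "summable a"
proof (rule bounded_imp_summable[OF a])
  fix n
  define s where "s = (\<Sum>k\<le>n. a k)"
  have s: "(\<Sum>k<n. a k) \<le> s" unfolding s_def using a by (intro sum_mono2) auto
  have "s = a 0 + (\<Sum>k<n. a (Suc k))"
    unfolding s_def by (metis lessThan_Suc_atMost sum.lessThan_Suc_shift)
  also have "(\<Sum>k<n. a (Suc k)) \<le> (\<Sum>k<n. \<Sum>j\<le>k. d j * a (k - j))"
    by (intro sum_mono renewal)
  also have "\<dots> = (\<Sum>(i, j)\<in>{(i, j). i + j < n}. d i * a j)"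
    by (rule sum.triangle_reindex[symmetric])
  \<comment> \<open>The triangle is enlarged to the square, where the double sum factorises.\<close>
  also have "\<dots> \<le> (\<Sum>(i, j)\<in>{..<n} \<times> {..<n}. d i * a j)"
    using a d by (intro sum_mono2) auto
  also have "\<dots> = (\<Sum>i<n. d i) * (\<Sum>j<n. a j)"
    by (simp add: sum_product sum.cartesian_product)
  also have "\<dots> \<le> q * s"
    using q(1)[of n] s a d by (intro mult_mono) (auto intro!: sum_nonneg order.trans[OF _ q(1)[of 0]])
  finally have "s * (1 - q) \<le> a 0" by (simp add: algebra_simps)
  then show "(\<Sum>k\<le>n. a k) \<le> a 0 / (1 - q)"
    using q(2) by (simp add: s_def field_simps)
qed

text \<open>On each interval of length \<open>\<delta>\<close>, \<open>f\<close> lies between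
  \<open>c\<close> times its value at the left end and its value at the right end divided by
  \<open>c\<close>. The integral is thus squeezed between integrals of two step functions;
  monotonicity is the only property of the integral of \<open>f\<close> that enters.\<close>

lemma nn_integral_eq_infinity_iff_not_summable:
  fixes f :: "real \<Rightarrow> real"
  assumes f: "\<And>t. 0 \<le> t \<Longrightarrow> 0 \<le> f t" and \<delta>: "0 < \<delta>" and c: "0 < c"
    and step: "\<And>s h. 0 \<le> s \<Longrightarrow> 0 \<le> h \<Longrightarrow> h \<le> \<delta> \<Longrightarrow> c * f s \<le> f (s + h)"
  shows "(\<integral>\<^sup>+t\<in>{0..}. ennreal (f t) \<partial>lborel) = \<infinity> \<longleftrightarrow> \<not> summable (\<lambda>k. f (real k * \<delta>))"
proof -
  define I where "I k = {real k * \<delta> ..< real (Suc k) * \<delta>}" for k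
  have I_floor: "nat \<lfloor>t / \<delta>\<rfloor> = k" if "t \<in> I k" for t k
  proof -
    have "real k \<le> t / \<delta>" "t / \<delta> < real k + 1"
      using that \<delta> by (auto simp: I_def field_simps)
    then have "\<lfloor>t / \<delta>\<rfloor> = int k" by (intro floor_unique) auto
    then show ?thesis by simp
  qed
  have disj: "disjoint_family I"
    unfolding disjoint_family_on_def using I_floor by blast
  have cover: "\<exists>k. t \<in> I k" if "0 \<le> t" for t
  proof (intro exI[of _ "nat \<lfloor>t / \<delta>\<rfloor>"])
    have "real (nat \<lfloor>t / \<delta>\<rfloor>) \<le> t / \<delta>" "t / \<delta> < real (nat \<lfloor>t / \<delta>\<rfloor>) + 1"
      using that \<delta> by (auto simp: of_nat_floor)
    then show "t \<in> I (nat \<lfloor>t / \<delta>\<rfloor>)" using \<delta> by (auto simp: I_def field_simps)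
  qed
  have nonneg: "0 \<le> t" if "t \<in> I k" for t k
  proof -
    have "0 \<le> real k * \<delta>" using \<delta> by simp
    then show ?thesis using that unfolding I_def by (simp only: atLeastLessThan_iff) linarith
  qed
  have int: "(\<integral>\<^sup>+t. (\<Sum>k. ennreal (g k) * indicator (I k) t) \<partial>lborel) = (\<Sum>k. ennreal (g k * \<delta>))"
    if "\<And>k. 0 \<le> g k" for g
  proof -
    have "(\<integral>\<^sup>+t. (\<Sum>k. ennreal (g k) * indicator (I k) t) \<partial>lborel) =
        (\<Sum>k. \<integral>\<^sup>+t. ennreal (g k) * indicator (I k) t \<partial>lborel)"
      by (intro nn_integral_suminf) (auto simp: I_def)
    also have "\<dots> = (\<Sum>k. ennreal (g k * \<delta>))"
    proof (intro suminf_cong)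
      fix k
      have "emeasure lborel (I k) = ennreal \<delta>"
        using \<delta> by (simp add: I_def algebra_simps)
      then show "(\<integral>\<^sup>+t. ennreal (g k) * indicator (I k) t \<partial>lborel) = ennreal (g k * \<delta>)"
        using that \<delta> by (subst nn_integral_cmult_indicator) (auto simp: I_def ennreal_mult)
    qed
    finally show ?thesis .
  qed
  have single: "(\<Sum>k. ennreal (g k) * indicator (I k) t) = ennreal (g j)" if "t \<in> I j" for g t j
    by (rule suminf_cmult_indicator[OF disj that])
  have k\<delta>: "0 \<le> real k * \<delta>" for k using \<delta> by simp
  show ?thesis
  proof
    assume inf: "(\<integral>\<^sup>+t\<in>{0..}. ennreal (f t) \<partial>lborel) = \<infinity>"
    show "\<not> summable (\<lambda>k. f (real k * \<delta>))"
    proof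
      assume "summable (\<lambda>k. f (real k * \<delta>))"
      \<comment> \<open>The upper bound uses right endpoints, hence the shifted series.\<close>
      then have "summable (\<lambda>k. f (real (Suc k) * \<delta>))" by (subst summable_Suc_iff)
      then have sum: "summable (\<lambda>k. f (real (Suc k) * \<delta>) / c * \<delta>)"
        by (intro summable_mult2 summable_divide)
      have "(\<integral>\<^sup>+t\<in>{0..}. ennreal (f t) \<partial>lborel) \<le>
          (\<integral>\<^sup>+t. (\<Sum>k. ennreal (f (real (Suc k) * \<delta>) / c) * indicator (I k) t) \<partial>lborel)"
      proof (rule nn_integral_mono)
        fix t
        show "ennreal (f t) * indicator {0..} t \<le> (\<Sum>k. ennreal (f (real (Suc k) * \<delta>) / c) * indicator (I k) t)"
        proof (cases "0 \<le> t")
          case True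
          then obtain k where k: "t \<in> I k" using cover by blast
          have "c * f t \<le> f (t + (real (Suc k) * \<delta> - t))"
            using k True by (intro step) (auto simp: I_def algebra_simps)
          then have "f t \<le> f (real (Suc k) * \<delta>) / c" using c by (simp add: field_simps)
          then show ?thesis unfolding single[OF k] using True by (simp add: ennreal_leI)
        qed simp
      qed
      also have "\<dots> = (\<Sum>k. ennreal (f (real (Suc k) * \<delta>) / c * \<delta>))"
        using f[OF k\<delta>] c by (intro int divide_nonneg_pos)
      finally have "(\<Sum>k. ennreal (f (real (Suc k) * \<delta>) / c * \<delta>)) = top"
        using inf by (simp add: top_unique)
      moreover have "(\<Sum>k. ennreal (f (real (Suc k) * \<delta>) / c * \<delta>)) \<noteq> top"
        using sum f[OF k\<delta>] \<delta> c by (intro ennreal_suminf_neq_top) (auto simp del: of_nat_Suc)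
      ultimately show False by contradiction
    qed
  next
    assume ns: "\<not> summable (\<lambda>k. f (real k * \<delta>))"
    have "\<not> summable (\<lambda>k. c * f (real k * \<delta>) * \<delta>)"
    proof
      assume "summable (\<lambda>k. c * f (real k * \<delta>) * \<delta>)"
      then have "summable (\<lambda>k. c * f (real k * \<delta>) * \<delta> / (c * \<delta>))" by (rule summable_divide)
      then show False using ns \<delta> c by simp
    qed
    then have top: "(\<Sum>k. ennreal (c * f (real k * \<delta>) * \<delta>)) = top"
      using summable_suminf_not_top[of "\<lambda>k. c * f (real k * \<delta>) * \<delta>"] f[OF k\<delta>] \<delta> c by fastforce
    have "(\<Sum>k. ennreal (c * f (real k * \<delta>) * \<delta>)) =
        (\<integral>\<^sup>+t. (\<Sum>k. ennreal (c * f (real k * \<delta>)) * indicator (I k) t) \<partial>lborel)"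
      using f[OF k\<delta>] c by (intro int[symmetric]) auto
    also have "\<dots> \<le> (\<integral>\<^sup>+t\<in>{0..}. ennreal (f t) \<partial>lborel)"
    proof (rule nn_integral_mono)
      fix t
      show "(\<Sum>k. ennreal (c * f (real k * \<delta>)) * indicator (I k) t) \<le> ennreal (f t) * indicator {0..} t"
      proof (cases "0 \<le> t")
        case True
        then obtain k where k: "t \<in> I k" using cover by blast
        have "c * f (real k * \<delta>) \<le> f (real k * \<delta> + (t - real k * \<delta>))"
          using k k\<delta> by (intro step) (auto simp: I_def algebra_simps)
        then show ?thesis unfolding single[OF k] using True by (simp add: ennreal_leI)
      next
        case False
        then have "indicator (I k) t = (0 :: ennreal)" for k using nonneg by (auto simp: indicator_def)
        then show ?thesis by simp
      qed
    qed
    finally show "(\<integral>\<^sup>+t\<in>{0..}. ennreal (f t) \<partial>lborel) = \<infinity>" using top by (simp add: top_unique)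
  qed
qed

section \<open>Occupation events\<close>

context coalescing_walk
begin

text \<open>The natural filtration of the clocks; \<open>prospect s\<close> is its counterpart
  generated by all increments after \<open>s\<close>.\<close>

definition history :: "real \<Rightarrow> 'a measure" where
  "history s = vimage_algebra (space M) (past s) arc_paths_space"

definition prospect :: "real \<Rightarrow> 'a measure" where
  "prospect s = vimage_algebra (space M) (future s) arc_paths_space"

definition occ :: "real \<Rightarrow> 'v \<Rightarrow> 'a set" where
  "occ t v = {\<omega>\<in>space M. occupied G (\<lambda>e u. N e u \<omega>) t v}"

definition restart :: "real \<Rightarrow> real \<Rightarrow> 'v \<Rightarrow> 'a set" where
  "restart s r v = {\<omega>\<in>space M. occupied G (\<lambda>e u. N e (s + u) \<omega> - N e s \<omega>) r v}"

lemma occ_iff: "\<omega> \<in> occ t v \<longleftrightarrow> \<omega> \<in> space M \<and> crw G N t \<omega> v = 1"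
  by (auto simp: occ_def occupied_def crw_def)

lemma occupation_prob_eq: "occupation_prob M G N t v = prob (occ t v)"
  unfolding occupation_prob_def by (rule arg_cong[where f = prob]) (auto simp: occ_iff)

lemma space_history [simp]: "space (history s) = space M"
  and space_prospect [simp]: "space (prospect s) = space M"
  by (simp_all add: history_def prospect_def)

lemma sets_history:
  assumes "0 \<le> s"
  shows "sets (history s) = {past s -` A \<inter> space M |A. A \<in> sets arc_paths_space}"
  unfolding history_def using measurable_space[OF measurable_past[OF assms]]
  by (intro sets_vimage_algebra2) auto

lemma sets_prospect:
  assumes "0 \<le> s"
  shows "sets (prospect s) = {future s -` A \<inter> space M |A. A \<in> sets arc_paths_space}"
  unfolding prospect_def using measurable_space[OF measurable_future[OF assms]]
  by (intro sets_vimage_algebra2) auto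

lemma history_events: "0 \<le> s \<Longrightarrow> a \<in> sets (history s) \<Longrightarrow> a \<in> events"
  and prospect_events: "0 \<le> s \<Longrightarrow> a \<in> sets (prospect s) \<Longrightarrow> a \<in> events"
  using measurable_sets[OF measurable_past] measurable_sets[OF measurable_future]
  by (auto simp: sets_history sets_prospect)

lemma prob_history_prospect:
  assumes "0 \<le> s" "a \<in> sets (history s)" "b \<in> sets (prospect s)"
  shows "prob (a \<inter> b) = prob a * prob b"
proof -
  obtain A where A: "A \<in> sets arc_paths_space" "a = past s -` A \<inter> space M"
    using assms(2) unfolding sets_history[OF assms(1)] by blast
  obtain B where B: "B \<in> sets arc_paths_space" "b = future s -` B \<inter> space M"
    using assms(3) unfolding sets_prospect[OF assms(1)] by blast
  show ?thesis unfolding A(2) B(2) by (rule prob_past_future[OF assms(1) A(1) B(1)])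
qed

text \<open>Stopping the clocks at \<open>s\<close> preserves all rings up to \<open>t\<close>, so
  occupation at \<open>t\<close> can be read off \<open>past s\<close>.\<close>

lemma occ_history:
  assumes "0 \<le> t" "t \<le> s"
  shows "occ t v \<in> sets (history s)"
proof -
  have s: "0 \<le> s" using assms by simp
  obtain A where A: "A \<in> sets arc_paths_space"
    "\<And>g. (\<And>e. e \<in> parcs G \<Longrightarrow> counting_path (g e)) \<Longrightarrow>
       clock_paths (parcs G) g \<in> A \<longleftrightarrow> occupied G g t v"
    using occupied_event[OF countable_verts countable_arcs] by blast
  have "past s \<omega> \<in> A \<longleftrightarrow> occupied G (\<lambda>e u. N e u \<omega>) t v" if \<omega>: "\<omega> \<in> space M" for \<omega>
  proof -
    have "past s \<omega> \<in> A \<longleftrightarrow> occupied G (\<lambda>e u. N e (min u s) \<omega>) t v"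
      unfolding past_def by (intro A(2) counting_path_stop clock_path \<omega> s)
    also have "\<dots> \<longleftrightarrow> occupied G (\<lambda>e u. N e u \<omega>) t v"
      unfolding occupied_def
    proof (intro bex_cong refl particle_at_local)
      fix e assume "e \<in> parcs G"
      then have "jump_times (\<lambda>u. N e (min u s) \<omega>) = jump_times (\<lambda>u. N e u \<omega>) \<inter> {..s}"
        by (intro jump_times_stop clock_path \<omega> s)
      moreover have "{..s} \<inter> {..t} = {..t}" using assms(2) by auto
      ultimately show "jump_times (\<lambda>u. N e (min u s) \<omega>) \<inter> {..t} = jump_times (\<lambda>u. N e u \<omega>) \<inter> {..t}"
        by (simp only: Int_assoc)
    qed
    finally show ?thesis .
  qed
  then have "occ t v = past s -` A \<inter> space M" by (auto simp: occ_def)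
  then show ?thesis using A(1) unfolding sets_history[OF s] by blast
qed

lemma occ_events: "0 \<le> t \<Longrightarrow> occ t v \<in> events"
  using occ_history[of t t] history_events by blast

text \<open>One measurable set \<open>A\<close> represents occupation for every family of counting
  paths. The restarted and the original event are its preimages under \<open>future s\<close> and
  \<open>paths\<close>, which have the same law.\<close>

lemma
  assumes s: "0 \<le> s"
  shows restart_prospect: "restart s r v \<in> sets (prospect s)"
    and prob_restart: "prob (restart s r v) = prob (occ r v)"
proof -
  obtain A where A: "A \<in> sets arc_paths_space"
    "\<And>g. (\<And>e. e \<in> parcs G \<Longrightarrow> counting_path (g e)) \<Longrightarrow>
       clock_paths (parcs G) g \<in> A \<longleftrightarrow> occupied G g r v"
    using occupied_event[OF countable_verts countable_arcs] by blast
  have "future s \<omega> \<in> A \<longleftrightarrow> occupied G (\<lambda>e u. N e (s + u) \<omega> - N e s \<omega>) r v" if \<omega>: "\<omega> \<in> space M" for \<omega>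
    unfolding future_def by (intro A(2) counting_path_shift clock_path \<omega> s)
  then have restart: "restart s r v = future s -` A \<inter> space M" by (auto simp: restart_def)
  have "paths \<omega> \<in> A \<longleftrightarrow> occupied G (\<lambda>e u. N e u \<omega>) r v" if \<omega>: "\<omega> \<in> space M" for \<omega>
    unfolding paths_def by (intro A(2) clock_path \<omega>)
  then have occ: "occ r v = paths -` A \<inter> space M" by (auto simp: occ_def)
  show "restart s r v \<in> sets (prospect s)"
    using A(1) restart unfolding sets_prospect[OF s] by blast
  show "prob (restart s r v) = prob (occ r v)"
    unfolding restart occ by (rule prob_future[OF s A(1)])
qed

lemma jump_times_future:
  assumes "\<omega> \<in> space M" "0 \<le> s" "e \<in> parcs G"
  shows "jump_times (\<lambda>u. N e (s + u) \<omega> - N e s \<omega>) = {t. 0 < t \<and> s + t \<in> jump_times (\<lambda>u. N e u \<omega>)}"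
  by (rule jump_times_shift[OF clock_path]) (use assms in auto)

text \<open>Monotonicity: at time \<open>s\<close> the restarted process has a particle at every vertex.\<close>

lemma occ_subset_restart:
  assumes "0 \<le> s" "s \<le> t"
  shows "occ t v \<subseteq> restart s (t - s) v"
proof
  fix \<omega> assume "\<omega> \<in> occ t v"
  then obtain x where \<omega>: "\<omega> \<in> space M" and "particle_at G (\<lambda>e. jump_times (\<lambda>u. N e u \<omega>)) x t v"
    by (auto simp: occ_def occupied_def)
  then obtain y where y: "y \<in> pverts G"
    "particle_at G (\<lambda>e. {t. 0 < t \<and> s + t \<in> jump_times (\<lambda>u. N e u \<omega>)}) y (t - s) v"
    using particle_at_restart[OF wf _ assms, of "\<lambda>e. jump_times (\<lambda>u. N e u \<omega>)" x v
        "\<lambda>e. {t. 0 < t \<and> s + t \<in> jump_times (\<lambda>u. N e u \<omega>)}"] by blast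
  have "particle_at G (\<lambda>e. jump_times (\<lambda>u. N e (s + u) \<omega> - N e s \<omega>)) y (t - s) v \<longleftrightarrow>
      particle_at G (\<lambda>e. {t. 0 < t \<and> s + t \<in> jump_times (\<lambda>u. N e u \<omega>)}) y (t - s) v"
    by (rule particle_at_local) (simp add: jump_times_future[OF \<omega> assms(1)])
  then show "\<omega> \<in> restart s (t - s) v"
    using y \<omega> by (auto simp: restart_def occupied_def)
qed

section \<open>Prescribed numbers of rings: staying at a site and moving to a neighbour\<close>

definition rings :: "real \<Rightarrow> real \<Rightarrow> ('v \<times> 'v) set \<Rightarrow> ('v \<times> 'v \<Rightarrow> nat) \<Rightarrow> 'a set" where
  "rings s h J k = {\<omega>\<in>space M. \<forall>e\<in>J. N e (s + h) \<omega> - N e s \<omega> = k e}"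

lemma
  assumes s: "0 \<le> s" and h: "0 < h" and J: "finite J" "J \<subseteq> parcs G"
  shows rings_prospect: "rings s h J k \<in> sets (prospect s)"
    and prob_rings: "prob (rings s h J k) = (\<Prod>e\<in>J. pmf (poisson_pmf h) (k e))"
proof -
  define F where "F e \<omega> = (\<lambda>t\<in>{0..}. N e (s + t) \<omega> - N e s \<omega>)" for e \<omega>
  define A where "A e = {f\<in>space (path_space {0..}). f h = k e}" for e
  have A: "A e \<in> sets (path_space {0..})" for e
  proof -
    have "(\<lambda>f. f h) \<in> measurable (path_space {0..}) (count_space UNIV)"
      using h by (intro measurable_component_singleton) simp
    from measurable_sets[OF this, of "{k e}"] have "(\<lambda>f. f h) -` {k e} \<inter> space (path_space {0..}) \<in> sets (path_space {0..})"
      by simp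
    also have "(\<lambda>f. f h) -` {k e} \<inter> space (path_space {0..}) = A e" by (auto simp: A_def)
    finally show ?thesis .
  qed
  have sing: "F e -` A e \<inter> space M = {\<omega>\<in>space M. N e (s + h) \<omega> - N e s \<omega> = k e}" for e
    using h by (auto simp: A_def F_def space_PiM)
  have fut: "future s \<omega> e = F e \<omega>" if "e \<in> parcs G" for e \<omega>
    using that by (simp add: future_def clock_paths_def F_def)
  have pros: "{\<omega>\<in>space M. N e (s + h) \<omega> - N e s \<omega> = k e} \<in> sets (prospect s)" if e: "e \<in> parcs G" for e
  proof -
    have "(\<lambda>g. g e) \<in> measurable arc_paths_space (path_space {0..})"
      by (rule measurable_component_singleton[OF e])
    from measurable_sets[OF this A[of e]]
    have "(\<lambda>g. g e) -` A e \<inter> space arc_paths_space \<in> sets arc_paths_space" .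
    moreover have "{\<omega>\<in>space M. N e (s + h) \<omega> - N e s \<omega> = k e} =
        future s -` ((\<lambda>g. g e) -` A e \<inter> space arc_paths_space) \<inter> space M"
      unfolding sing[symmetric] using measurable_space[OF measurable_future[OF s]] fut[OF e] by auto
    ultimately show ?thesis unfolding sets_prospect[OF s] by blast
  qed
  \<comment> \<open>An intersection over the empty set would be the whole type instead of
    \<open>space M\<close>; empty \<open>J\<close> is therefore treated apart.\<close>
  have inter: "rings s h J k = (\<Inter>e\<in>J. {\<omega>\<in>space M. N e (s + h) \<omega> - N e s \<omega> = k e})" if "J \<noteq> {}"
    using that by (auto simp: rings_def)
  show "rings s h J k \<in> sets (prospect s)"
  proof (cases "J = {}")
    case True
    then show ?thesis using sets.top[of "prospect s"] by (simp add: rings_def)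
  next
    case False
    then show ?thesis unfolding inter[OF False] using J pros by (intro sets.finite_INT) auto
  qed
  show "prob (rings s h J k) = (\<Prod>e\<in>J. pmf (poisson_pmf h) (k e))"
  proof (cases "J = {}")
    case True
    then show ?thesis by (simp add: rings_def prob_space)
  next
    case False
    have "indep_vars (\<lambda>_. path_space {0..}) F (parcs G)"
      using indep_future_clocks[OF s] by (simp add: F_def[abs_def])
    then have "prob (\<Inter>e\<in>J. F e -` A e \<inter> space M) = (\<Prod>e\<in>J. prob (F e -` A e \<inter> space M))"
      by (rule indep_varsD[OF _ False J A])
    then have "prob (rings s h J k) = (\<Prod>e\<in>J. prob {\<omega>\<in>space M. N e (s + h) \<omega> - N e s \<omega> = k e})"
      unfolding sing inter[OF False] .
    also have "\<dots> = (\<Prod>e\<in>J. pmf (poisson_pmf h) (k e))"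
    proof (rule prod.cong[OF refl])
      fix e assume "e \<in> J"
      then have e: "poisson_process M 1 (N e)" using J clock_process by blast
      note meas = poisson_process_measurable[OF e]
      have [measurable]: "(\<lambda>\<omega>. N e (s + h) \<omega> - N e s \<omega>) \<in> measurable M (count_space UNIV)"
      proof -
        have [measurable]: "N e (s + h) \<in> measurable M (count_space UNIV)" "N e s \<in> measurable M (count_space UNIV)"
          using meas s h by auto
        show ?thesis by measurable
      qed
      have "distr M (count_space UNIV) (\<lambda>\<omega>. N e (s + h) \<omega> - N e s \<omega>) = measure_pmf (poisson_pmf (1 * (s + h - s)))"
        using e s h unfolding poisson_process_def by (metis less_add_same_cancel1)
      then have law: "distr M (count_space UNIV) (\<lambda>\<omega>. N e (s + h) \<omega> - N e s \<omega>) = measure_pmf (poisson_pmf h)"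
        by simp
      have "{\<omega>\<in>space M. N e (s + h) \<omega> - N e s \<omega> = k e} = (\<lambda>\<omega>. N e (s + h) \<omega> - N e s \<omega>) -` {k e} \<inter> space M"
        by auto
      then have "prob {\<omega>\<in>space M. N e (s + h) \<omega> - N e s \<omega> = k e} =
          measure (distr M (count_space UNIV) (\<lambda>\<omega>. N e (s + h) \<omega> - N e s \<omega>)) {k e}"
        by (simp add: measure_distr)
      then show "prob {\<omega>\<in>space M. N e (s + h) \<omega> - N e s \<omega> = k e} = pmf (poisson_pmf h) (k e)"
        unfolding law by (simp add: pmf.rep_eq)
    qed
    finally show ?thesis .
  qed
qed

lemma no_jumps:
  assumes "\<omega> \<in> space M" "e \<in> parcs G" "0 \<le> s" "N e (s + h) \<omega> - N e s \<omega> = 0" "r \<le> s + h"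
  shows "jump_times (\<lambda>u. N e u \<omega>) \<inter> {s<..r} = {}"
proof (cases "s \<le> r")
  case True
  have path: "counting_path (\<lambda>u. N e u \<omega>)" by (rule clock_path) fact+
  have "N e s \<omega> \<le> N e r \<omega>" "N e r \<omega> \<le> N e (s + h) \<omega>"
    using counting_path_mono[OF path] assms True by auto
  then show ?thesis using assms by (intro jump_times_disjoint[OF path]) auto
qed simp

lemma occ_stay:
  assumes s: "0 \<le> s" and h: "0 \<le> h'" "h' \<le> h"
  shows "occ s v \<inter> rings s h (out_arcs (with_proj G) v) (\<lambda>_. 0) \<subseteq> occ (s + h') v"
proof
  fix \<omega> assume \<omega>: "\<omega> \<in> occ s v \<inter> rings s h (out_arcs (with_proj G) v) (\<lambda>_. 0)"
  then obtain x where x: "\<omega> \<in> space M" "x \<in> pverts G" "particle_at G (\<lambda>e. jump_times (\<lambda>u. N e u \<omega>)) x s v"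
    by (auto simp: occ_def occupied_def)
  have "particle_at G (\<lambda>e. jump_times (\<lambda>u. N e u \<omega>)) x (s + h') v"
  proof (rule particle_at_stay[OF x(3)])
    fix e assume e: "e \<in> out_arcs (with_proj G) v"
    then have "N e (s + h) \<omega> - N e s \<omega> = 0" using \<omega> unfolding rings_def by blast
    moreover have "e \<in> parcs G" using e by simp
    ultimately show "jump_times (\<lambda>u. N e u \<omega>) \<inter> {s<..s + h'} = {}"
      using x(1) s h by (intro no_jumps[where h = h]) simp_all
  qed (use h in simp)
  then show "\<omega> \<in> occ (s + h') v" using x by (auto simp: occ_def occupied_def)
qed

text \<open>One ring of \<open>(v, w)\<close> and silence on every other arc leaving
  \<open>v\<close> or \<open>w\<close> force the particle to jump to \<open>w\<close> and to wait
  there until \<open>s + 1\<close>. The silence includes the reverse arc.\<close>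

lemma occ_move:
  assumes s: "0 \<le> s" and vw: "(v, w) \<in> parcs G"
  shows "occ s v \<inter> rings s 1 (out_arcs (with_proj G) v \<union> out_arcs (with_proj G) w)
      (\<lambda>e. if e = (v, w) then 1 else 0) \<subseteq> occ (s + 1) w" (is "_ \<inter> rings s 1 ?J ?k \<subseteq> _")
proof
  fix \<omega> assume \<omega>: "\<omega> \<in> occ s v \<inter> rings s 1 ?J ?k"
  then obtain x where x: "\<omega> \<in> space M" "x \<in> pverts G" "particle_at G (\<lambda>e. jump_times (\<lambda>u. N e u \<omega>)) x s v"
    by (auto simp: occ_def occupied_def)
  have inc: "N e (s + 1) \<omega> - N e s \<omega> = ?k e" if "e \<in> ?J" for e
    using \<omega> that by (auto simp: rings_def)
  have vw_out: "(v, w) \<in> out_arcs (with_proj G) v" using vw by simp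
  \<comment> \<open>Otherwise the arc that rings would itself leave \<open>w\<close>.\<close>
  have "v \<noteq> w"
    using pair_loopfree_digraph.pair_no_loops[OF _ vw] bidirected by (auto simp: pair_bidirected_digraph_def)
  have none: "jump_times (\<lambda>u. N e u \<omega>) \<inter> {s<..s + 1} = {}" if "e \<in> ?J" "e \<noteq> (v, w)" for e
    using inc[OF that(1)] that x(1) s by (intro no_jumps[where h = 1]) auto
  have path: "counting_path (\<lambda>u. N (v, w) u \<omega>)" by (rule clock_path[OF x(1) vw])
  have lt: "N (v, w) s \<omega> < N (v, w) (s + 1) \<omega>" using inc[of "(v, w)"] vw_out by simp
  obtain r where r: "r \<in> jump_times (\<lambda>u. N (v, w) u \<omega>)" "s < r" "r \<le> s + 1"
    "jump_times (\<lambda>u. N (v, w) u \<omega>) \<inter> {s<..<r} = {}"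
    by (rule first_jump[OF path s lt]) auto
  have "particle_at G (\<lambda>e. jump_times (\<lambda>u. N e u \<omega>)) x r w"
  proof (rule particle_at_jump[OF x(3) r(2) vw r(1)])
    fix e assume e: "e \<in> out_arcs (with_proj G) v"
    show "jump_times (\<lambda>u. N e u \<omega>) \<inter> {s<..<r} = {}"
    proof (cases "e = (v, w)")
      case False
      have "{s<..<r} \<subseteq> {s<..s + 1}" using r by auto
      then show ?thesis using none[of e] e False by blast
    qed (use r in simp)
  qed
  then have "particle_at G (\<lambda>e. jump_times (\<lambda>u. N e u \<omega>)) x (s + 1) w"
  proof (rule particle_at_stay[OF _ r(3)])
    fix e assume e: "e \<in> out_arcs (with_proj G) w"
    then have "e \<noteq> (v, w)" using \<open>v \<noteq> w\<close> by (cases e) auto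
    moreover have "{r<..s + 1} \<subseteq> {s<..s + 1}" using r by auto
    ultimately show "jump_times (\<lambda>u. N e u \<omega>) \<inter> {r<..s + 1} = {}" using none[of e] e by blast
  qed
  then show "\<omega> \<in> occ (s + 1) w" using x by (auto simp: occ_def occupied_def)
qed

lemma out_arcs_parcs: "out_arcs (with_proj G) v \<subseteq> parcs G"
  by (auto simp: out_arcs_def)

lemma prod_pmf_poisson_pos: "0 < h \<Longrightarrow> 0 < (\<Prod>e\<in>J. pmf (poisson_pmf h) (k e))"
  by (intro prod_pos) simp

text \<open>For \<open>h > 0\<close> this is \<open>exp (- h * deg v)\<close>, the probability that
  no arc out of \<open>v\<close> rings during time \<open>h\<close>.\<close>

definition stay_prob :: "real \<Rightarrow> 'v \<Rightarrow> real" where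
  "stay_prob h v = (\<Prod>e\<in>out_arcs (with_proj G) v. pmf (poisson_pmf h) 0)"

lemma stay_prob_pos: "0 < h \<Longrightarrow> 0 < stay_prob h v"
  unfolding stay_prob_def by (rule prod_pmf_poisson_pos)

text \<open>Staying is decided by increments after \<open>s\<close>, hence independent of occupation
  at \<open>s\<close>. The factor is uniform in \<open>s\<close>, as the comparison of integral and
  series requires.\<close>

lemma prob_occ_stay:
  assumes "0 \<le> s" "0 < h" "0 \<le> h'" "h' \<le> h"
  shows "stay_prob h v * prob (occ s v) \<le> prob (occ (s + h') v)"
proof -
  let ?R = "rings s h (out_arcs (with_proj G) v) (\<lambda>_. 0)"
  have "stay_prob h v * prob (occ s v) = prob (occ s v) * prob ?R"
    unfolding prob_rings[OF assms(1,2) finite_out_arcs out_arcs_parcs] stay_prob_def by simp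
  also have "\<dots> = prob (occ s v \<inter> ?R)"
    by (rule prob_history_prospect[symmetric])
      (use assms in \<open>auto intro!: occ_history rings_prospect finite_out_arcs out_arcs_parcs\<close>)
  also have "\<dots> \<le> prob (occ (s + h') v)"
    using occ_stay[OF assms(1,3,4)] assms by (intro finite_measure_mono occ_events) auto
  finally show ?thesis .
qed

lemma prob_occ_move:
  assumes vw: "(v, w) \<in> parcs G"
  obtains c where "0 < c" "\<And>s. 0 \<le> s \<Longrightarrow> c * prob (occ s v) \<le> prob (occ (s + 1) w)"
proof
  let ?J = "out_arcs (with_proj G) v \<union> out_arcs (with_proj G) w"
  let ?k = "\<lambda>e. if e = (v, w) then 1 else 0 :: nat"
  let ?c = "\<Prod>e\<in>?J. pmf (poisson_pmf 1) (?k e)"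
  have J: "finite ?J" "?J \<subseteq> parcs G" using finite_out_arcs out_arcs_parcs by auto
  show "0 < ?c" by (rule prod_pmf_poisson_pos) simp
  fix s :: real assume s: "0 \<le> s"
  have "?c * prob (occ s v) = prob (occ s v) * prob (rings s 1 ?J ?k)"
    using prob_rings[OF s _ J, of 1 ?k] by simp
  also have "\<dots> = prob (occ s v \<inter> rings s 1 ?J ?k)"
    by (rule prob_history_prospect[symmetric, OF s occ_history[OF s order.refl] rings_prospect[OF s _ J]]) simp
  also have "\<dots> \<le> prob (occ (s + 1) w)"
    using occ_move[OF s vw] s by (intro finite_measure_mono occ_events) auto
  finally show "?c * prob (occ s v) \<le> prob (occ (s + 1) w)" .
qed

section \<open>Decomposition according to the first visit\<close>

text \<open>The set \<open>disjointed\<close> at \<open>i\<close> says that the first visit along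
  the grid has index \<open>i\<close>. It involves grid times up to \<open>t i\<close> only, so the
  Markov property at the fixed time \<open>t i\<close> applies to it.\<close>

lemma
  fixes t :: "nat \<Rightarrow> real"
  assumes t: "mono t" "0 \<le> t 0"
  shows first_visit_history: "disjointed (\<lambda>j. occ (t j) v) i \<in> sets (history (t i))"
    and first_visit_events: "disjointed (\<lambda>j. occ (t j) v) i \<in> events"
proof -
  have t0: "0 \<le> t j" for j using monoD[OF t(1), of 0 j] t(2) by simp
  show *: "disjointed (\<lambda>j. occ (t j) v) i \<in> sets (history (t i))"
    unfolding disjointed_def
    by (intro sets.Diff sets.finite_UN occ_history t0 order.refl) (auto intro!: occ_history t0 monoD[OF t(1)])
  show "disjointed (\<lambda>j. occ (t j) v) i \<in> events" by (rule history_events[OF t0 *])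
qed

text \<open>After the first visit along the grid, staying for a further time \<open>h\<close>
  suffices to be seen at \<open>u\<close>, and it is independent of the history. The factor depends
  neither on \<open>n\<close> nor on the mesh, so the grid may be refined.\<close>

lemma prob_visit_le:
  fixes t :: "nat \<Rightarrow> real"
  assumes t: "mono t" "0 \<le> t 0" and h: "0 < h"
    and u: "\<And>j. j < n \<Longrightarrow> t j \<le> u \<and> u \<le> t j + h"
  shows "stay_prob h v * prob (\<Union>j<n. occ (t j) v) \<le> prob (occ u v)"
proof (cases "n = 0")
  case True
  then show ?thesis by simp
next
  case False
  have t0: "0 \<le> t j" for j using monoD[OF t(1), of 0 j] t(2) by simp
  have u0: "0 \<le> u" using u[of 0] False t(2) by auto
  define D where "D = disjointed (\<lambda>j. occ (t j) v)"
  define R where "R j = rings (t j) h (out_arcs (with_proj G) v) (\<lambda>_. 0)" for j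
  have D: "D j \<in> sets (history (t j))" "D j \<in> events" for j
    unfolding D_def by (rule first_visit_history[OF t] first_visit_events[OF t])+
  have R: "R j \<in> sets (prospect (t j))" "R j \<in> events" "prob (R j) = stay_prob h v" for j
    using rings_prospect[OF t0[of j] h finite_out_arcs out_arcs_parcs, of v "\<lambda>_. 0"]
      prob_rings[OF t0[of j] h finite_out_arcs out_arcs_parcs, of v "\<lambda>_. 0"] prospect_events[OF t0[of j]]
    by (auto simp: R_def stay_prob_def)
  have disj: "disjoint_family D" unfolding D_def by (rule disjoint_family_disjointed)
  have "(\<Union>j<n. occ (t j) v) = (\<Union>j<n. D j)"
    using finite_UN_disjointed_eq[of "\<lambda>j. occ (t j) v" n] by (simp add: D_def lessThan_atLeast0)
  then have "prob (\<Union>j<n. occ (t j) v) = (\<Sum>j<n. prob (D j))"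
    using D disj by (simp add: finite_measure_finite_Union image_subset_iff disjoint_family_on_def)
  then have "stay_prob h v * prob (\<Union>j<n. occ (t j) v) = (\<Sum>j<n. prob (D j) * prob (R j))"
    by (simp add: R sum_distrib_left mult.commute)
  also have "\<dots> = (\<Sum>j<n. prob (D j \<inter> R j))"
    by (intro sum.cong refl) (rule prob_history_prospect[OF t0 D(1) R(1), symmetric])
  also have "\<dots> = prob (\<Union>j<n. D j \<inter> R j)"
  proof (rule finite_measure_finite_Union[symmetric])
    show "disjoint_family_on (\<lambda>j. D j \<inter> R j) {..<n}"
      using disj unfolding disjoint_family_on_def by blast
  qed (use D R in auto)
  also have "\<dots> \<le> prob (occ u v)"
  proof (intro finite_measure_mono occ_events u0 UN_least)
    fix j assume j: "j \<in> {..<n}"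
    have "D j \<subseteq> occ (t j) v" unfolding D_def by (rule disjointed_subset)
    then show "D j \<inter> R j \<subseteq> occ u v"
      using occ_stay[OF t0[of j], of "u - t j" h v] u[of j] j unfolding R_def by auto
  qed
  finally show ?thesis .
qed

text \<open>If the walk misses all positive multiples of \<open>\<delta>\<close> with positive probability, then the
  number of visits at multiples of \<open>\<delta>\<close> is dominated by a geometric variable.\<close>

lemma prob_visit_multiple:
  assumes \<delta>: "0 < \<delta>" and ns: "\<not> summable (\<lambda>k. prob (occ (real k * \<delta>) v))"
  shows "prob (\<Union>j. occ (real (Suc j) * \<delta>) v) = 1"
proof -
  \<comment> \<open>Only positive multiples count: at time 0 every vertex is occupied.\<close>
  let ?t = "\<lambda>j. real (Suc j) * \<delta>"
  have t: "mono ?t" "0 \<le> ?t 0" using \<delta> by (auto intro!: monoI)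
  have t0: "0 \<le> ?t j" for j using \<delta> by simp
  define D where "D = disjointed (\<lambda>j. occ (?t j) v)"
  define q where "q = prob (\<Union>j. occ (?t j) v)"
  have D: "D j \<in> sets (history (?t j))" "D j \<in> events" for j
    unfolding D_def by (rule first_visit_history[OF t] first_visit_events[OF t])+
  have disj: "disjoint_family D" unfolding D_def by (rule disjoint_family_disjointed)
  have ev: "(\<Union>j. occ (?t j) v) \<in> events" using occ_events[OF t0] by auto
  have renewal: "prob (occ (?t k) v) \<le> (\<Sum>j\<le>k. prob (D j) * prob (occ (real (k - j) * \<delta>) v))" for k
  proof -
    have "occ (?t k) v \<subseteq> (\<Union>j\<in>{0..<Suc k}. occ (?t j) v)" by (intro UN_upper) simp
    also have "\<dots> = (\<Union>j\<in>{0..<Suc k}. D j)" unfolding D_def by (rule finite_UN_disjointed_eq[symmetric])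
    also have "{0..<Suc k} = {..k}" by auto
    finally have "occ (?t k) v = (\<Union>j\<le>k. D j \<inter> occ (?t k) v)" by auto
    then have "prob (occ (?t k) v) = prob (\<Union>j\<le>k. D j \<inter> occ (?t k) v)" by simp
    also have "\<dots> = (\<Sum>j\<le>k. prob (D j \<inter> occ (?t k) v))"
    proof (rule finite_measure_finite_Union)
      show "disjoint_family_on (\<lambda>j. D j \<inter> occ (?t k) v) {..k}"
        using disj unfolding disjoint_family_on_def by blast
    qed (use D occ_events[OF t0[of k]] in auto)
    also have "\<dots> \<le> (\<Sum>j\<le>k. prob (D j) * prob (occ (real (k - j) * \<delta>) v))"
    proof (rule sum_mono)
      fix j assume j: "j \<in> {..k}"
      have le: "?t j \<le> ?t k" using monoD[OF t(1)] j by auto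
      \<comment> \<open>The index shifts of \<open>?t\<close> cancel, so the remaining time is again
        a multiple of \<open>\<delta>\<close>, possibly 0.\<close>
      have diff: "?t k - ?t j = real (k - j) * \<delta>" using j by (simp add: of_nat_diff algebra_simps)
      \<comment> \<open>Occupation at \<open>?t k\<close> is not independent of the first visit, but
        the larger restart event is; this is where equality becomes an inequality.\<close>
      have "prob (D j \<inter> occ (?t k) v) \<le> prob (D j \<inter> restart (?t j) (?t k - ?t j) v)"
        using occ_subset_restart[OF t0[of j] le, of v] D restart_prospect[OF t0[of j]] prospect_events[OF t0[of j]]
        by (intro finite_measure_mono) auto
      also have "\<dots> = prob (D j) * prob (restart (?t j) (?t k - ?t j) v)"
        by (rule prob_history_prospect[OF t0 D(1) restart_prospect[OF t0]])
      also have "\<dots> = prob (D j) * prob (occ (real (k - j) * \<delta>) v)"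
        unfolding prob_restart[OF t0] diff ..
      finally show "prob (D j \<inter> occ (?t k) v) \<le> prob (D j) * prob (occ (real (k - j) * \<delta>) v)" .
    qed
    finally show ?thesis .
  qed
  have sum_le: "(\<Sum>j<n. prob (D j)) \<le> q" for n
  proof -
    have "(\<Sum>j<n. prob (D j)) = prob (\<Union>j<n. D j)"
    proof (rule finite_measure_finite_Union[symmetric])
      show "disjoint_family_on D {..<n}"
        using disj unfolding disjoint_family_on_def by blast
    qed (use D in auto)
    also have "\<dots> \<le> q"
      unfolding q_def
    proof (intro finite_measure_mono ev UN_least)
      fix j
      have "D j \<subseteq> occ (?t j) v" unfolding D_def by (rule disjointed_subset)
      then show "D j \<subseteq> (\<Union>j. occ (?t j) v)" by blast
    qed
    finally show ?thesis .
  qed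
  have "\<not> q < 1"
  proof
    assume "q < 1"
    have "summable (\<lambda>k. prob (occ (real k * \<delta>) v))"
      by (rule renewal_summable[OF _ _ renewal sum_le \<open>q < 1\<close>]) simp_all
    with ns show False by contradiction
  qed
  moreover have "q \<le> 1" unfolding q_def by (rule prob_le_1)
  ultimately show ?thesis unfolding q_def by linarith
qed

section \<open>Visits at arbitrarily late times\<close>

definition unbounded_visits :: "'v \<Rightarrow> 'a \<Rightarrow> bool" where
  "unbounded_visits v \<omega> \<longleftrightarrow> \<not> bdd_above {t. 0 \<le> t \<and> crw G N t \<omega> v = 1}"

text \<open>Arranged by dyadic levels, so that the finite unions increase with \<open>m\<close> and
  bounds on finite grids pass to the limit.\<close>

definition visits :: "nat \<Rightarrow> 'v \<Rightarrow> 'a set" where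
  "visits n v = (\<Union>m. \<Union>j<2 ^ m. occ (real n + real j / 2 ^ m) v)"

lemma visits_events: "visits n v \<in> events"
  unfolding visits_def by (intro sets.countable_UN'' occ_events) auto

text \<open>Sites stay occupied for a positive time, so that dyadic times detect every visit.\<close>

lemma visits_iff:
  "\<omega> \<in> visits n v \<longleftrightarrow> (\<exists>t. real n \<le> t \<and> t < real n + 1 \<and> \<omega> \<in> occ t v)"
proof
  assume "\<omega> \<in> visits n v"
  then obtain m j where j: "j < 2 ^ m" "\<omega> \<in> occ (real n + real j / 2 ^ m) v"
    by (auto simp: visits_def)
  have "real j < 2 ^ m" using j(1) by (metis of_nat_less_iff of_nat_numeral of_nat_power)
  with j(2) show "\<exists>t. real n \<le> t \<and> t < real n + 1 \<and> \<omega> \<in> occ t v"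
    by (intro exI[of _ "real n + real j / 2 ^ m"]) auto
next
  assume "\<exists>t. real n \<le> t \<and> t < real n + 1 \<and> \<omega> \<in> occ t v"
  then obtain t where t: "real n \<le> t" "t < real n + 1" "\<omega> \<in> occ t v" by blast
  then have t0: "0 \<le> t" by (meson of_nat_0_le_iff order.trans)
  from t(3) obtain x where x: "\<omega> \<in> space M" "x \<in> pverts G" "particle_at G (\<lambda>e. jump_times (\<lambda>u. N e u \<omega>)) x t v"
    by (auto simp: occ_def occupied_def)
  have "\<exists>d>0. \<forall>s. t \<le> s \<and> s \<le> t + d \<longrightarrow> N e s \<omega> = N e t \<omega>" if "e \<in> parcs G" for e
    using counting_path_right_const[OF clock_path[OF x(1) that] t0] by metis
  then obtain d where d: "\<And>e. e \<in> parcs G \<Longrightarrow> 0 < d e"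
      "\<And>e s. e \<in> parcs G \<Longrightarrow> t \<le> s \<Longrightarrow> s \<le> t + d e \<Longrightarrow> N e s \<omega> = N e t \<omega>"
    by metis
  \<comment> \<open>Positive because only finitely many arcs leave \<open>v\<close>. The entry
    \<open>real n + 1 - t\<close> keeps the dyadic time inside the window.\<close>
  define r where "r = Min (insert (real n + 1 - t) (d ` out_arcs (with_proj G) v))"
  have r: "0 < r" "r \<le> real n + 1 - t" "\<And>e. e \<in> out_arcs (with_proj G) v \<Longrightarrow> r \<le> d e"
    using d(1) t(2) finite_out_arcs[of v] unfolding r_def by auto
  obtain m where m: "inverse (2 ^ m) < r" using real_arch_pow_inv[OF r(1), of "1/2"] by (auto simp: field_simps)
  \<comment> \<open>Rounding up gives a dyadic time at or after \<open>t\<close>, and the mesh is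
    below \<open>r\<close>.\<close>
  define j where "j = nat \<lceil>(t - real n) * 2 ^ m\<rceil>"
  have "0 \<le> (t - real n) * 2 ^ m" using t by simp
  then have j: "(t - real n) * 2 ^ m \<le> real j" "real j < (t - real n) * 2 ^ m + 1"
    unfolding j_def by linarith+
  let ?s = "real n + real j / 2 ^ m"
  have s: "t \<le> ?s" "?s < t + r"
  proof -
    have "t - real n \<le> real j / 2 ^ m" using j(1) by (simp add: field_simps)
    then show "t \<le> ?s" by simp
    have "real j / 2 ^ m < t - real n + inverse (2 ^ m)" using j(2) by (simp add: field_simps)
    then show "?s < t + r" using m by simp
  qed
  have "real j / 2 ^ m < 1" using s(2) r(2) by linarith
  then have "real j < real (2 ^ m)" by (simp add: field_simps)
  then have "j < 2 ^ m" by (simp only: of_nat_less_iff)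
  moreover have "particle_at G (\<lambda>e. jump_times (\<lambda>u. N e u \<omega>)) x ?s v"
  proof (rule particle_at_stay[OF x(3) s(1)])
    fix e assume e: "e \<in> out_arcs (with_proj G) v"
    then have eG: "e \<in> parcs G" by simp
    have "N e t \<omega> = N e ?s \<omega>" using d(2)[OF eG s(1)] s(2) r(3)[OF e] by simp
    then show "jump_times (\<lambda>u. N e u \<omega>) \<inter> {t<..?s} = {}"
      by (rule jump_times_disjoint[OF clock_path[OF x(1) eG] t0])
  qed
  ultimately show "\<omega> \<in> visits n v" using x by (auto simp: visits_def occ_def occupied_def)
qed

lemma unbounded_visits_iff:
  assumes \<omega>: "\<omega> \<in> space M"
  shows "unbounded_visits v \<omega> \<longleftrightarrow> (\<forall>n. \<exists>k\<ge>n. \<omega> \<in> visits k v)"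
proof
  assume unb: "unbounded_visits v \<omega>"
  show "\<forall>n. \<exists>k\<ge>n. \<omega> \<in> visits k v"
  proof
    fix n
    obtain t where t: "0 \<le> t" "crw G N t \<omega> v = 1" "real n < t"
      using unb unfolding unbounded_visits_def bdd_above_def by (auto simp: not_le)
    have "real (nat \<lfloor>t\<rfloor>) \<le> t" "t < real (nat \<lfloor>t\<rfloor>) + 1" using t(1) by (auto simp: of_nat_floor)
    moreover have "\<omega> \<in> occ t v" using t \<omega> by (simp add: occ_iff)
    ultimately have "\<omega> \<in> visits (nat \<lfloor>t\<rfloor>) v" unfolding visits_iff by blast
    moreover have "n \<le> nat \<lfloor>t\<rfloor>" using t(3) by (simp add: le_nat_floor)
    ultimately show "\<exists>k\<ge>n. \<omega> \<in> visits k v" by blast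
  qed
next
  assume io: "\<forall>n. \<exists>k\<ge>n. \<omega> \<in> visits k v"
  show "unbounded_visits v \<omega>"
    unfolding unbounded_visits_def
  proof
    assume "bdd_above {t. 0 \<le> t \<and> crw G N t \<omega> v = 1}"
    then obtain b where b: "\<And>t. 0 \<le> t \<Longrightarrow> crw G N t \<omega> v = 1 \<Longrightarrow> t \<le> b" by (auto simp: bdd_above_def)
    obtain n :: nat where n: "b < real n" using reals_Archimedean2 by blast
    obtain k where k: "n \<le> k" "\<omega> \<in> visits k v" using io by blast
    then obtain t where t: "real k \<le> t" "\<omega> \<in> occ t v" unfolding visits_iff by blast
    have "0 \<le> t" using t(1) by (meson of_nat_0_le_iff order.trans)
    then have "t \<le> b" using b t(2) by (simp add: occ_iff)
    then show False using n k(1) t(1) by linarith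
  qed
qed

lemma unbounded_visits_events: "{\<omega>\<in>space M. unbounded_visits v \<omega>} \<in> events"
proof -
  have "{\<omega>\<in>space M. unbounded_visits v \<omega>} = (\<Inter>n. \<Union>k\<in>{n..}. visits k v)"
    using unbounded_visits_iff[of _ v] sets.sets_into_space[OF visits_events] by fastforce
  also have "\<dots> \<in> events"
  proof (rule sets.countable_INT')
    have "(\<Union>k\<in>{n..}. visits k v) \<in> events" for n
      using visits_events by (intro sets.countable_UN'') auto
    then show "(\<lambda>n. \<Union>k\<in>{n..}. visits k v) ` UNIV \<subseteq> events" by auto
  qed auto
  finally show ?thesis .
qed

lemma all_visited_eq: "all_visited_infinitely_often G N \<omega> \<longleftrightarrow> (\<forall>v\<in>pverts G. unbounded_visits v \<omega>)"
  by (simp add: all_visited_infinitely_often_def unbounded_visits_def)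

lemma all_visited_events: "{\<omega>\<in>space M. all_visited_infinitely_often G N \<omega>} \<in> events"
proof -
  have "{\<omega>\<in>space M. all_visited_infinitely_often G N \<omega>} = (\<Inter>v\<in>pverts G. {\<omega>\<in>space M. unbounded_visits v \<omega>})"
    using verts_nonempty by (auto simp: all_visited_eq)
  also have "\<dots> \<in> events"
    using unbounded_visits_events by (intro sets.countable_INT' countable_verts verts_nonempty) auto
  finally show ?thesis .
qed

text \<open>All dyadic times of the window lie within distance 1 of its right end, so the grid bound
  with \<open>h = 1\<close> and \<open>u = Suc n\<close> holds at every level; continuity from below
  does the rest.\<close>

lemma prob_visits_le: "prob (visits n v) \<le> prob (occ (real (Suc n)) v) / stay_prob 1 v"
proof -
  define V where "V m = (\<Union>j<2 ^ m. occ (real n + real j / 2 ^ m) v)" for m :: nat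
  have V: "V m \<in> events" for m unfolding V_def by (intro sets.finite_UN occ_events) auto
  have "incseq V"
  proof (rule incseq_SucI, rule subsetI)
    fix m \<omega> assume "\<omega> \<in> V m"
    then obtain j where j: "j < 2 ^ m" "\<omega> \<in> occ (real n + real j / 2 ^ m) v" by (auto simp: V_def)
    have "real j / 2 ^ m = real (2 * j) / 2 ^ Suc m" by simp
    then show "\<omega> \<in> V (Suc m)" unfolding V_def using j by (intro UN_I[of "2 * j"]) auto
  qed
  have "stay_prob 1 v * prob (V m) \<le> prob (occ (real (Suc n)) v)" for m
    unfolding V_def
  proof (rule prob_visit_le)
    show "mono (\<lambda>j. real n + real j / 2 ^ m)" by (intro monoI) (simp add: divide_right_mono)
    fix j :: nat assume "j < 2 ^ m"
    then have "real j < 2 ^ m" by (metis of_nat_less_iff of_nat_numeral of_nat_power)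
    then show "real n + real j / 2 ^ m \<le> real (Suc n) \<and> real (Suc n) \<le> real n + real j / 2 ^ m + 1"
      by simp
  qed simp_all
  then have le: "prob (V m) \<le> prob (occ (real (Suc n)) v) / stay_prob 1 v" for m
    using stay_prob_pos[of 1 v] by (simp add: field_simps)
  have "(\<lambda>m. prob (V m)) \<longlonglongrightarrow> prob (\<Union>m. V m)"
    using V \<open>incseq V\<close> by (intro finite_Lim_measure_incseq) auto
  then have "prob (\<Union>m. V m) \<le> prob (occ (real (Suc n)) v) / stay_prob 1 v"
    by (rule LIMSEQ_le_const2) (use le in auto)
  then show ?thesis by (simp add: visits_def V_def)
qed

text \<open>Borel--Cantelli is applied to visits in unit windows. A window is controlled by its
  right end, whence the passage to \<open>Suc k\<close>.\<close>

lemma AE_bounded_visits: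
  assumes "summable (\<lambda>k. prob (occ (real k) v))"
  shows "AE \<omega> in M. \<not> unbounded_visits v \<omega>"
proof -
  have "summable (\<lambda>k. prob (occ (real (Suc k)) v))" using assms by (subst summable_Suc_iff)
  then have "summable (\<lambda>k. prob (occ (real (Suc k)) v) / stay_prob 1 v)" by (rule summable_divide)
  then have "summable (\<lambda>k. prob (visits k v))"
    by (rule summable_comparison_test'[of _ 0]) (use prob_visits_le in simp)
  then have "AE \<omega> in M. \<forall>\<^sub>F k in sequentially. \<omega> \<in> space M - visits k v"
    using visits_events by (intro borel_cantelli_AE1) (auto simp: emeasure_eq_measure)
  then show ?thesis
  proof eventually_elim
    case (elim \<omega>)
    then obtain n where n: "\<And>k. n \<le> k \<Longrightarrow> \<omega> \<in> space M - visits k v" by (auto simp: eventually_sequentially)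
    then show ?case using unbounded_visits_iff[of \<omega> v] by blast
  qed
qed

text \<open>Stated for every mesh \<open>\<delta>\<close>: since the left side does not involve it,
  the series for different meshes diverge together.\<close>

lemma nn_integral_occupation_prob:
  assumes "0 < \<delta>"
  shows "(\<integral>\<^sup>+t\<in>{0..}. ennreal (occupation_prob M G N t v) \<partial>lborel) = \<infinity> \<longleftrightarrow>
     \<not> summable (\<lambda>k. prob (occ (real k * \<delta>) v))"
  unfolding occupation_prob_eq
  by (rule nn_integral_eq_infinity_iff_not_summable[OF _ assms stay_prob_pos[OF assms] prob_occ_stay[OF _ assms]])
    simp_all

lemma AE_unbounded_visits:
  assumes "\<not> summable (\<lambda>k. prob (occ (real k) v))"
  shows "AE \<omega> in M. unbounded_visits v \<omega>"
proof -
  have "(\<integral>\<^sup>+t\<in>{0..}. ennreal (occupation_prob M G N t v) \<partial>lborel) = \<infinity>"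
    using nn_integral_occupation_prob[of 1 v] assms by simp
  \<comment> \<open>The integral serves as intermediary between mesh 1 and mesh
    \<open>Suc m\<close>.\<close>
  then have ns: "\<not> summable (\<lambda>k. prob (occ (real k * real (Suc m)) v))" for m
    using nn_integral_occupation_prob[of "real (Suc m)" v] by simp
  have ev: "(\<Union>j. occ (real (Suc j) * real (Suc m)) v) \<in> events" for m
    by (intro sets.countable_UN'' occ_events) auto
  have "AE \<omega> in M. \<omega> \<in> (\<Union>j. occ (real (Suc j) * real (Suc m)) v)" for m
    using prob_visit_multiple[OF _ ns[of m]] AE_in_set_eq_1[OF ev[of m]] by simp
  then have "AE \<omega> in M. \<forall>m. \<omega> \<in> (\<Union>j. occ (real (Suc j) * real (Suc m)) v)"
    unfolding AE_all_countable by (rule allI)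
  then show ?thesis
  proof eventually_elim
    case (elim \<omega>)
    show ?case
      unfolding unbounded_visits_def
    proof
      assume "bdd_above {t. 0 \<le> t \<and> crw G N t \<omega> v = 1}"
      then obtain b where b: "\<And>t. 0 \<le> t \<Longrightarrow> crw G N t \<omega> v = 1 \<Longrightarrow> t \<le> b" by (auto simp: bdd_above_def)
      \<comment> \<open>A visit at a positive multiple of \<open>Suc m\<close> is later than any
        bound below \<open>real m\<close>.\<close>
      obtain m :: nat where m: "b < real m" using reals_Archimedean2 by blast
      obtain j where j: "\<omega> \<in> occ (real (Suc j) * real (Suc m)) v" using elim by blast
      then have "real (Suc j) * real (Suc m) \<le> b" by (intro b) (auto simp: occ_iff)
      moreover have "real m \<le> real (Suc j) * real (Suc m)"
      proof -
        have "m \<le> Suc j * Suc m" by simp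
        then show ?thesis by (metis of_nat_le_iff of_nat_mult)
      qed
      ultimately show False using m by linarith
    qed
  qed
qed

section \<open>Independence of the site, and the dichotomy\<close>

lemma summable_occ_adjacent:
  assumes "(v, w) \<in> parcs G" "summable (\<lambda>k. prob (occ (real k) w))"
  shows "summable (\<lambda>k. prob (occ (real k) v))"
proof -
  obtain c where c: "0 < c" "\<And>s. 0 \<le> s \<Longrightarrow> c * prob (occ s v) \<le> prob (occ (s + 1) w)"
    using prob_occ_move[OF assms(1)] by blast
  have "summable (\<lambda>k. prob (occ (real (Suc k)) w))" using assms(2) by (subst summable_Suc_iff)
  then have "summable (\<lambda>k. prob (occ (real (Suc k)) w) / c)" by (rule summable_divide)
  then show ?thesis
  proof (rule summable_comparison_test'[of _ 0])
    fix k :: nat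
    have "c * prob (occ (real k) v) \<le> prob (occ (real (Suc k)) w)"
      using c(2)[of "real k"] by (simp add: add.commute)
    then show "norm (prob (occ (real k) v)) \<le> prob (occ (real (Suc k)) w) / c"
      using c(1) by (simp add: field_simps)
  qed
qed

text \<open>Convergence passes from the head of an arc to its tail, and the directed arcs connect
  any two vertices in both directions.\<close>

lemma summable_occ_iff:
  assumes "v \<in> pverts G" "w \<in> pverts G"
  shows "summable (\<lambda>k. prob (occ (real k) v)) \<longleftrightarrow> summable (\<lambda>k. prob (occ (real k) w))"
proof -
  have "summable (\<lambda>k. prob (occ (real k) w)) \<Longrightarrow> summable (\<lambda>k. prob (occ (real k) v))"
    if "(v, w) \<in> (parcs G)\<^sup>*" for v w
    using that by (induction rule: converse_rtrancl_induct) (auto intro: summable_occ_adjacent)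
  then show ?thesis using arc_path assms by blast
qed

lemma site_recurrent_if_not_summable:
  assumes "v \<in> pverts G" "\<not> summable (\<lambda>k. prob (occ (real k) v))"
  shows "site_recurrent M G N"
proof -
  have "AE \<omega> in M. unbounded_visits w \<omega>" if "w \<in> pverts G" for w
    using AE_unbounded_visits summable_occ_iff[OF assms(1) that] assms(2) by blast
  then have "AE \<omega> in M. \<forall>w\<in>pverts G. unbounded_visits w \<omega>"
    by (simp add: AE_ball_countable[OF countable_verts])
  then show ?thesis by (simp add: site_recurrent_def all_visited_eq)
qed

lemma transient_if_summable:
  assumes "v \<in> pverts G" "summable (\<lambda>k. prob (occ (real k) v))"
  shows "transient M G N"
  unfolding transient_def AE_iff_null_sets[OF all_visited_events]
  using AE_bounded_visits[OF assms(2)] by eventually_elim (use assms(1) in \<open>auto simp: all_visited_eq\<close>)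

text \<open>Otherwise an almost sure event would be null. This exclusion turns the two implications,
  from divergence to recurrence and from convergence to transience, into the equivalence.\<close>

lemma not_recurrent_and_transient: "\<not> (site_recurrent M G N \<and> transient M G N)"
proof
  assume *: "site_recurrent M G N \<and> transient M G N"
  then have "AE \<omega> in M. \<omega> \<notin> {\<omega>\<in>space M. all_visited_infinitely_often G N \<omega>}"
    unfolding transient_def AE_iff_null_sets[OF all_visited_events] by blast
  moreover have "AE \<omega> in M. all_visited_infinitely_often G N \<omega>"
    using * by (simp add: site_recurrent_def)
  ultimately have "AE \<omega> in M. False"
    using AE_space by eventually_elim auto
  then show False by simp
qed

end

theorem proposition1:
  fixes G :: "'v pair_pre_digraph"
    and M :: "'a measure"
    and N :: "'v \<times> 'v \<Rightarrow> real \<Rightarrow> 'a \<Rightarrow> nat"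
  assumes "pair_bidirected_digraph G"
    and "connected_graph G"
    and "locally_finite_graph G"
    and "prob_space M"
    and "poisson_clocks M G N"
  shows "(\<forall>v \<in> pverts G.
            site_recurrent M G N \<longleftrightarrow>
            (\<integral>\<^sup>+t\<in>{0..}. ennreal (occupation_prob M G N t v) \<partial>lborel) = \<infinity>) \<and>
         (site_recurrent M G N \<or> transient M G N)"
proof -
  interpret coalescing_walk M G N
    using assms by (simp add: coalescing_walk_def coalescing_walk_axioms_def)
  show ?thesis
  proof (intro conjI ballI)
    fix v assume v: "v \<in> pverts G"
    have "(\<integral>\<^sup>+t\<in>{0..}. ennreal (occupation_prob M G N t v) \<partial>lborel) = \<infinity> \<longleftrightarrow>
        \<not> summable (\<lambda>k. prob (occ (real k) v))"
      using nn_integral_occupation_prob[of 1 v] by simp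
    then show "site_recurrent M G N \<longleftrightarrow>
        (\<integral>\<^sup>+t\<in>{0..}. ennreal (occupation_prob M G N t v) \<partial>lborel) = \<infinity>"
      using site_recurrent_if_not_summable[OF v] transient_if_summable[OF v] not_recurrent_and_transient
      by blast
  next
    obtain v where v: "v \<in> pverts G" using verts_nonempty by blast
    show "site_recurrent M G N \<or> transient M G N"
      using site_recurrent_if_not_summable[OF v] transient_if_summable[OF v] by blast
  qed
qed

end
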